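(* Let $q\in(0,1)$, $n\ge1$. There exists a unique homomorphism of $*$-algebras $\psi:\mathrm{Pol}(\mathrm{Mat}_n)_q\to\mathrm{Pol}(S(\mathbb{U}))_q$ such that $\psi(z_a^\alpha)=z_a^\alpha$ for all $a,\alpha=1,\dots,n$.
   Context: All algebras are unital over $\mathbb{C}$. $\mathbb{C}[\mathrm{Mat}_n]_q$ is the algebra with generators $z_a^\alpha$, $a,\alpha=1,\dots,n$, and relations (R): $z_a^\alpha z_b^\beta-qz_b^\beta z_a^\alpha=0$ if ($a=b$ and $\alpha<\beta$) or ($a<b$ and $\alpha=\beta$); $z_a^\alpha z_b^\beta-z_b^\beta z_a^\alpha=0$ if $\alpha<\beta$ and $a>b$; $z_a^\alpha z_b^\beta-z_b^\beta z_a^\alpha=(q-q^{-1})z_a^\beta z_b^\alpha$ if $\alpha<\beta$ and $a<b$. $\mathrm{Pol}(\mathrm{Mat}_n)_q$ is the $*$-algebra with generators $z_a^\alpha,(z_a^\alpha)^*$, $a,\alpha=1,\dots,n$, subject to the relations (R) and $$(z_b^\beta)^*z_a^\alpha=q^2\sum_{a',b',\alpha',\beta'=1}^nR_{ba}^{b'a'}R_{\beta\alpha}^{\beta'\alpha'}z_{a'}^{\alpha'}(z_{b'}^{\beta'})^*+(1-q^2)\delta_{ab}\delta^{\alpha\beta},$$ where $R_{ij}^{kl}=q^{-1}$ if $i\ne j$, $i=k$, $j=l$; $R_{ij}^{kl}=1$ if $i=j=k=l$; $R_{ij}^{kl}=-(q^{-2}-1)$ if $i=j$, $k=l$, $l>j$;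 $R_{ij}^{kl}=0$ otherwise. Quantum minors: for $a_1<\dots<a_k$, $\alpha_1<\dots<\alpha_k$, $(z^{\wedge k})_{\{a_i\}}^{\{\alpha_i\}}=\sum_{s\in S_k}(-q)^{l(s)}z_{a_1}^{\alpha_{s(1)}}\cdots z_{a_k}^{\alpha_{s(k)}}$ ($l(s)$ = number of inversions); $\det_q\mathbf{z}=(z^{\wedge n})_{\{1..n\}}^{\{1..n\}}$ (central); $\det_q\mathbf{z}_a^\alpha=(z^{\wedge(n-1)})_{\{1..n\}\setminus\{a\}}^{\{1..n\}\setminus\{\alpha\}}$. $\mathbb{C}[GL_n]_q$ is the localization of $\mathbb{C}[\mathrm{Mat}_n]_q$ at the powers of $\det_q\mathbf{z}$. $\mathrm{Pol}(S(\mathbb{U}))_q$ denotes $\mathbb{C}[GL_n]_q$ equipped with the unique involution $*$ satisfying $(z_a^\alpha)^*=(-q)^{a+\alpha-2n}(\det_q\mathbf{z})^{-1}\det_q\mathbf{z}_a^\alpha$. *)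

theory Defs
  imports Complex_Main "HOL-Algebra.Ring" "HOL-Library.FuncSet"
begin

datatype 'g expr = EGen 'g | EScal complex | EAdd "'g expr" "'g expr" | EMul "'g expr" "'g expr"

text \<open>The congruence generated by the axioms of a unital associative C-algebra
  and a set R of relations (pairs lhs = rhs).  The quotient of expressions by it
  is the unital C-algebra presented by generators 'g and relations R.\<close>
inductive pcong :: "('g expr \<times> 'g expr) set \<Rightarrow> 'g expr \<Rightarrow> 'g expr \<Rightarrow> bool"
  for R :: "('g expr \<times> 'g expr) set" where
  prel: "(l, r) \<in> R \<Longrightarrow> pcong R l r"
| prefl: "pcong R x x"
| psym: "pcong R x y \<Longrightarrow> pcong R y x"
| ptrans: "pcong R x y \<Longrightarrow> pcong R y z \<Longrightarrow> pcong R x z"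
| padd_cong: "pcong R x x' \<Longrightarrow> pcong R y y' \<Longrightarrow> pcong R (EAdd x y) (EAdd x' y')"
| pmul_cong: "pcong R x x' \<Longrightarrow> pcong R y y' \<Longrightarrow> pcong R (EMul x y) (EMul x' y')"
| padd_assoc: "pcong R (EAdd (EAdd x y) z) (EAdd x (EAdd y z))"
| padd_comm: "pcong R (EAdd x y) (EAdd y x)"
| padd_zero: "pcong R (EAdd x (EScal 0)) x"
| padd_neg: "pcong R (EAdd x (EMul (EScal (-1)) x)) (EScal 0)"
| pmul_assoc: "pcong R (EMul (EMul x y) z) (EMul x (EMul y z))"
| pmul_one_l: "pcong R (EMul (EScal 1) x) x"
| pmul_one_r: "pcong R (EMul x (EScal 1)) x"
| pdistl: "pcong R (EMul x (EAdd y z)) (EAdd (EMul x y) (EMul x z))"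
| pdistr: "pcong R (EMul (EAdd x y) z) (EAdd (EMul x z) (EMul y z))"
| pscal_add: "pcong R (EScal (a + b)) (EAdd (EScal a) (EScal b))"
| pscal_mul: "pcong R (EScal (a * b)) (EMul (EScal a) (EScal b))"
| pscal_central: "pcong R (EMul (EScal c) x) (EMul x (EScal c))"

definition pclass :: "('g expr \<times> 'g expr) set \<Rightarrow> 'g expr \<Rightarrow> 'g expr set" where
  "pclass R e = {e'. pcong R e e'}"

definition pres_alg :: "('g expr \<times> 'g expr) set \<Rightarrow> 'g expr set ring" where
  "pres_alg R = \<lparr> carrier = range (pclass R),
     mult = (\<lambda>X Y. \<Union>x\<in>X. \<Union>y\<in>Y. pclass R (EMul x y)),
     one = pclass R (EScal 1),
     zero = pclass R (EScal 0),
     add = (\<lambda>X Y. \<Union>x\<in>X. \<Union>y\<in>Y. pclass R (EAdd x y)) \<rparr>"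

definition pres_smul :: "('g expr \<times> 'g expr) set \<Rightarrow> complex \<Rightarrow> 'g expr set \<Rightarrow> 'g expr set" where
  "pres_smul R c X = (\<Union>x\<in>X. pclass R (EMul (EScal c) x))"

definition esum :: "'g expr list \<Rightarrow> 'g expr" where
  "esum xs = foldr EAdd xs (EScal 0)"

definition eprod :: "'g expr list \<Rightarrow> 'g expr" where
  "eprod xs = foldr EMul xs (EScal 1)"

function perms :: "'a list \<Rightarrow> 'a list list" where
  "perms [] = [[]]"
| "perms (y # ys) = concat (map (\<lambda>x. map ((#) x) (perms (remove1 x (y # ys)))) (y # ys))"
  by pat_completeness auto
termination
  by (relation "measure length") (auto simp: length_remove1 dest: length_pos_if_in_set)

definition inversions :: "nat list \<Rightarrow> nat" where
  "inversions xs = card {(i, j). i < j \<and> j < length xs \<and> xs ! i > xs ! j}"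

text \<open>Quantum minor with rows as and columns als (both increasing lists), generator
  z_a^alpha given by zg a alpha:
  sum over permutations s of (-q)^l(s) z_{a_1}^{al_{s(1)}} ... z_{a_k}^{al_{s(k)}}.\<close>
definition qminor :: "(nat \<Rightarrow> nat \<Rightarrow> 'g) \<Rightarrow> real \<Rightarrow> nat list \<Rightarrow> nat list \<Rightarrow> 'g expr" where
  "qminor zg q as als = esum (map (\<lambda>bs. EMul (EScal (of_real ((-q) ^ inversions bs)))
        (eprod (map2 (\<lambda>a b. EGen (zg a b)) as bs))) (perms als))"

definition idx :: "nat \<Rightarrow> nat list" where
  "idx n = [1..<n+1]"

definition qdet :: "(nat \<Rightarrow> nat \<Rightarrow> 'g) \<Rightarrow> real \<Rightarrow> nat \<Rightarrow> 'g expr" where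
  "qdet zg q n = qminor zg q (idx n) (idx n)"

definition qdet_compl :: "(nat \<Rightarrow> nat \<Rightarrow> 'g) \<Rightarrow> real \<Rightarrow> nat \<Rightarrow> nat \<Rightarrow> nat \<Rightarrow> 'g expr" where
  "qdet_compl zg q n a al = qminor zg q (filter (\<lambda>i. i \<noteq> a) (idx n)) (filter (\<lambda>i. i \<noteq> al) (idx n))"

text \<open>The relations (R), plus relations z_a^alpha = 0 for out-of-range indices
  (so that only the n^2 generators with indices in 1..n remain).\<close>
definition relR :: "(nat \<Rightarrow> nat \<Rightarrow> 'g) \<Rightarrow> real \<Rightarrow> nat \<Rightarrow> ('g expr \<times> 'g expr) set" where
  "relR zg q n =
    {(EMul (EGen (zg a al)) (EGen (zg b be)), EMul (EScal (of_real q)) (EMul (EGen (zg b be)) (EGen (zg a al))))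
      | a b al be. a \<in> {1..n} \<and> b \<in> {1..n} \<and> al \<in> {1..n} \<and> be \<in> {1..n} \<and>
          ((a = b \<and> al < be) \<or> (a < b \<and> al = be))}
  \<union> {(EMul (EGen (zg a al)) (EGen (zg b be)), EMul (EGen (zg b be)) (EGen (zg a al)))
      | a b al be. a \<in> {1..n} \<and> b \<in> {1..n} \<and> al \<in> {1..n} \<and> be \<in> {1..n} \<and> al < be \<and> a > b}
  \<union> {(EMul (EGen (zg a al)) (EGen (zg b be)),
       EAdd (EMul (EGen (zg b be)) (EGen (zg a al)))
            (EMul (EScal (of_real (q - 1 / q))) (EMul (EGen (zg a be)) (EGen (zg b al)))))
      | a b al be. a \<in> {1..n} \<and> b \<in> {1..n} \<and> al \<in> {1..n} \<and> be \<in> {1..n} \<and> al < be \<and> a < b}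
  \<union> {(EGen (zg a al), EScal 0) | a al. a \<notin> {1..n} \<or> al \<notin> {1..n}}"

definition Rc :: "real \<Rightarrow> nat \<Rightarrow> nat \<Rightarrow> nat \<Rightarrow> nat \<Rightarrow> real" where
  "Rc q i j k l =
    (if i \<noteq> j \<and> i = k \<and> j = l then 1 / q
     else if i = j \<and> j = k \<and> k = l then 1
     else if i = j \<and> k = l \<and> l > j then - (1 / q ^ 2 - 1)
     else 0)"

datatype genA = Zg nat nat | Zsg nat nat

fun gstar :: "genA \<Rightarrow> genA" where
  "gstar (Zg a al) = Zsg a al"
| "gstar (Zsg a al) = Zg a al"

fun estar :: "genA expr \<Rightarrow> genA expr" where
  "estar (EGen g) = EGen (gstar g)"
| "estar (EScal c) = EScal (cnj c)"
| "estar (EAdd x y) = EAdd (estar x) (estar y)"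
| "estar (EMul x y) = EMul (estar y) (estar x)"

definition relCross :: "real \<Rightarrow> nat \<Rightarrow> (genA expr \<times> genA expr) set" where
  "relCross q n =
    {(EMul (EGen (Zsg b be)) (EGen (Zg a al)),
      EAdd (EMul (EScal (of_real (q ^ 2)))
              (esum (concat (concat (concat
                 (map (\<lambda>a'. map (\<lambda>b'. map (\<lambda>al'. map (\<lambda>be'.
                    EMul (EScal (of_real (Rc q b a b' a' * Rc q be al be' al')))
                         (EMul (EGen (Zg a' al')) (EGen (Zsg b' be'))))
                   (idx n)) (idx n)) (idx n)) (idx n)))))))
           (EScal (of_real ((1 - q ^ 2) * (if a = b \<and> al = be then 1 else 0)))))
     | a b al be. a \<in> {1..n} \<and> b \<in> {1..n} \<and> al \<in> {1..n} \<and> be \<in> {1..n}}"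

definition relMat :: "real \<Rightarrow> nat \<Rightarrow> (genA expr \<times> genA expr) set" where
  "relMat q n = (let S = relR Zg q n \<union> relCross q n in S \<union> (\<lambda>(l, r). (estar l, estar r)) ` S)"

definition PolMat :: "real \<Rightarrow> nat \<Rightarrow> genA expr set ring" where
  "PolMat q n = pres_alg (relMat q n)"

definition starMat :: "real \<Rightarrow> nat \<Rightarrow> genA expr set \<Rightarrow> genA expr set" where
  "starMat q n X = (\<Union>x\<in>X. pclass (relMat q n) (estar x))"

datatype genB = ZBg nat nat | Tg

text \<open>Localization of C[Mat_n]_q at the powers of det_q z: adjoin a two-sided inverse T.\<close>
definition relGL :: "real \<Rightarrow> nat \<Rightarrow> (genB expr \<times> genB expr) set" where
  "relGL q n = relR ZBg q n
     \<union> {(EMul (EGen Tg) (qdet ZBg q n), EScal 1), (EMul (qdet ZBg q n) (EGen Tg), EScal 1)}"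

definition GLq :: "real \<Rightarrow> nat \<Rightarrow> genB expr set ring" where
  "GLq q n = pres_alg (relGL q n)"

definition is_involution :: "genB expr set ring \<Rightarrow> (complex \<Rightarrow> genB expr set \<Rightarrow> genB expr set)
    \<Rightarrow> (genB expr set \<Rightarrow> genB expr set) \<Rightarrow> bool" where
  "is_involution A sm f \<longleftrightarrow>
     f \<in> carrier A \<rightarrow> carrier A \<and>
     (\<forall>x\<in>carrier A. f (f x) = x) \<and>
     (\<forall>x\<in>carrier A. \<forall>y\<in>carrier A. f (x \<oplus>\<^bsub>A\<^esub> y) = f x \<oplus>\<^bsub>A\<^esub> f y) \<and>
     (\<forall>x\<in>carrier A. \<forall>y\<in>carrier A. f (x \<otimes>\<^bsub>A\<^esub> y) = f y \<otimes>\<^bsub>A\<^esub> f x) \<and>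
     (\<forall>c. \<forall>x\<in>carrier A. f (sm c x) = sm (cnj c) (f x))"

text \<open>The involution of Pol(S(U))_q: the unique involution with
  (z_a^alpha)^* = (-q)^(a+alpha-2n) (det_q z)^-1 det_q z_a^alpha.\<close>
definition starSU :: "real \<Rightarrow> nat \<Rightarrow> genB expr set \<Rightarrow> genB expr set" where
  "starSU q n = (SOME f. f \<in> carrier (GLq q n) \<rightarrow>\<^sub>E carrier (GLq q n) \<and>
      is_involution (GLq q n) (pres_smul (relGL q n)) f \<and>
      (\<forall>a\<in>{1..n}. \<forall>al\<in>{1..n}.
         f (pclass (relGL q n) (EGen (ZBg a al))) =
         pclass (relGL q n)
           (EMul (EScal (complex_of_real (- q) powi (int a + int al - 2 * int n)))
                 (EMul (EGen Tg) (qdet_compl ZBg q n a al)))))"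

end

theory Submission
  imports Defs "HOL-Library.Multiset"
begin

text \<open>
  Write (R) in the form \<open>R Z\<^sub>1 Z\<^sub>2 = Z\<^sub>2 Z\<^sub>1 R\<close>. The quantum Laplace expansions show that \<open>det\<^sub>q z\<close>
  is central and that, up to row scalings, the elements \<open>(z\<^sub>a\<^sup>\<alpha>)\<^sup>*\<close> are the entries of the transposed
  inverse of \<open>Z\<close>. Multiplying the matrix identity by \<open>Z\<^sup>-\<^sup>1\<close> on both sides of one or of both factors then
  yields the commutation relations between \<open>z\<close> and \<open>z\<^sup>*\<close>, and those among the \<open>z\<^sup>*\<close>,
  which are (R) in the opposite algebra. A Cauchy--Binet argument identifies the quantum determinant
  of the matrix \<open>z\<^sup>*\<close> with a multiple of \<open>(det\<^sub>q z)\<^sup>-\<^sup>1\<close>, so that the Laplace expansion in the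
  opposite algebra gives \<open>z\<^sup>*\<^sup>* = z\<close>. Hence the involution exists, and \<open>\<psi>\<close> is defined on
  generators; its uniqueness is clear, since the \<open>z\<^sub>a\<^sup>\<alpha>\<close> generate as a \<open>*\<close>-algebra.
\<close>

section \<open>Quantum matrices and Laplace expansions\<close>

text \<open>The matrix calculus is carried out in the type class \<open>real_algebra_1\<close>,
  whereas the target algebra depends on \<open>q\<close> and \<open>n\<close> and is not known in
  advance to be nontrivial. The computations therefore live in one fixed product type, and
  \<open>emb_GL\<close> translates its equations into congruences and back. The class has only real
  scalars; this suffices because all structure constants are real, and complex scalars enter as
  elements \<open>scal c\<close>. Since the involution reverses products, every statement about the
  adjoint matrix is an instance of the same theory over the opposite algebra \<open>op\<close>. The
  involution of the target is given by a choice operator, so an explicit one has to be built on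
  expressions, and compatibility of \<psi> may then appeal only to the defining properties of the
  chosen one.\<close>

text \<open>A single identity, symmetric under transposition, equivalent to the relations (R); it is the
  entrywise form of \<open>R Z\<^sub>1 Z\<^sub>2 = Z\<^sub>2 Z\<^sub>1 R\<close>. It is imposed for all indices, since
  outside \<open>{1..n}\<close> the generators vanish.\<close>

definition qmat :: "real \<Rightarrow> (nat \<Rightarrow> nat \<Rightarrow> 'a::real_algebra_1) \<Rightarrow> bool" where
  "qmat q z \<longleftrightarrow> (\<forall>a b \<alpha> \<beta>.
     (if a = b then q else 1) *\<^sub>R (z a \<alpha> * z b \<beta>) + (if b < a then q - 1 / q else 0) *\<^sub>R (z b \<alpha> * z a \<beta>)
   = (if \<alpha> = \<beta> then q else 1) *\<^sub>R (z b \<beta> * z a \<alpha>) + (if \<alpha> < \<beta> then q - 1 / q else 0) *\<^sub>R (z b \<alpha> * z a \<beta>))"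

lemma qmatD:
  assumes "qmat q z"
  shows "(if a = b then q else 1) *\<^sub>R (z a \<alpha> * z b \<beta>) + (if b < a then q - 1 / q else 0) *\<^sub>R (z b \<alpha> * z a \<beta>)
   = (if \<alpha> = \<beta> then q else 1) *\<^sub>R (z b \<beta> * z a \<alpha>) + (if \<alpha> < \<beta> then q - 1 / q else 0) *\<^sub>R (z b \<alpha> * z a \<beta>)"
  using assms unfolding qmat_def by blast

lemma qmat_same_row:
  assumes "qmat q z" "\<alpha> < \<beta>"
  shows "z a \<alpha> * z a \<beta> = q *\<^sub>R (z a \<beta> * z a \<alpha>)"
  using qmatD[OF assms(1), of a a \<beta> \<alpha>] assms(2) by simp

lemma qmat_same_col:
  assumes "qmat q z" "a < b"
  shows "z a \<alpha> * z b \<alpha> = q *\<^sub>R (z b \<alpha> * z a \<alpha>)"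
  using qmatD[OF assms(1), of a b \<alpha> \<alpha>] assms(2) by simp

lemma qmat_commute:
  assumes "qmat q z" "a < b" "\<beta> < \<alpha>"
  shows "z a \<alpha> * z b \<beta> = z b \<beta> * z a \<alpha>"
  using qmatD[OF assms(1), of a b \<alpha> \<beta>] assms(2,3) by simp

lemma qmat_cross:
  assumes "qmat q z" "a < b" "\<alpha> < \<beta>"
  shows "z a \<alpha> * z b \<beta> = z b \<beta> * z a \<alpha> + (q - 1 / q) *\<^sub>R (z a \<beta> * z b \<alpha>)"
  using qmatD[OF assms(1), of a b \<alpha> \<beta>] assms(2,3) qmat_commute[OF assms] by simp

lemma qmatI:
  assumes q: "q \<noteq> 0"
    and row: "\<And>a \<alpha> \<beta>. \<alpha> < \<beta> \<Longrightarrow> z a \<alpha> * z a \<beta> = q *\<^sub>R (z a \<beta> * z a \<alpha>)"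
    and col: "\<And>a b \<alpha>. a < b \<Longrightarrow> z a \<alpha> * z b \<alpha> = q *\<^sub>R (z b \<alpha> * z a \<alpha>)"
    and com: "\<And>a b \<alpha> \<beta>. a < b \<Longrightarrow> \<beta> < \<alpha> \<Longrightarrow> z a \<alpha> * z b \<beta> = z b \<beta> * z a \<alpha>"
    and cross: "\<And>a b \<alpha> \<beta>. a < b \<Longrightarrow> \<alpha> < \<beta> \<Longrightarrow>
      z a \<alpha> * z b \<beta> = z b \<beta> * z a \<alpha> + (q - 1 / q) *\<^sub>R (z a \<beta> * z b \<alpha>)"
  shows "qmat q z"
  unfolding qmat_def
proof (intro allI, goal_cases)
  case (1 a b \<alpha> \<beta>)
  consider "a = b" "\<alpha> = \<beta>" | "a = b" "\<alpha> < \<beta>" | "a = b" "\<beta> < \<alpha>" | "a < b" "\<alpha> = \<beta>" | "b < a" "\<alpha> = \<beta>"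
    | "a < b" "\<alpha> < \<beta>" | "a < b" "\<beta> < \<alpha>" | "b < a" "\<alpha> < \<beta>" | "b < a" "\<beta> < \<alpha>"
    by (metis linorder_neqE_nat)
  then show ?case
  proof cases
    case 2
    then show ?thesis using row[of \<alpha> \<beta> a] q by (simp add: algebra_simps)
  next
    case 3
    then show ?thesis using row[of \<beta> \<alpha> a] q by (simp add: algebra_simps)
  next
    case 4
    then show ?thesis using col[of a b \<alpha>] q by (simp add: algebra_simps)
  next
    case 5
    then show ?thesis using col[of b a \<alpha>] q by (simp add: algebra_simps)
  next
    case 6
    then show ?thesis using cross[of a b \<alpha> \<beta>] com[of a b \<alpha> \<beta>] com[of a b \<beta> \<alpha>] by simp
  next
    case 7
    then show ?thesis using com[of a b \<beta> \<alpha>] by simp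
  next
    case 8
    then show ?thesis using com[of b a \<alpha> \<beta>] by simp
  next
    case 9
    then show ?thesis using cross[of b a \<beta> \<alpha>] com[of b a \<alpha> \<beta>] by (simp add: algebra_simps)
  qed simp
qed

lemma qmat_transpose:
  assumes "qmat q z" "q \<noteq> 0"
  shows "qmat q (\<lambda>a \<alpha>. z \<alpha> a)"
proof (rule qmatI[OF assms(2)], goal_cases)
  case 1 then show ?case by (rule qmat_same_col[OF assms(1)])
next
  case 2 then show ?case by (rule qmat_same_row[OF assms(1)])
next
  case (3 a b \<alpha> \<beta>) then show ?case using qmat_commute[OF assms(1), of \<beta> \<alpha> a b] by simp
next
  case (4 a b \<alpha> \<beta>) then show ?case
    using qmat_cross[OF assms(1), of \<alpha> \<beta> a b] qmat_commute[OF assms(1), of \<alpha> \<beta> a b] by simp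
qed

text \<open>Each monomial of the identity takes one entry from row \<open>a\<close> and one from row
  \<open>b\<close>, so \<open>s a * s b\<close> factors out. This carries the relations of the
  inverse matrix over to the adjoint matrix.\<close>

lemma qmat_scale_rows:
  assumes "qmat q z"
  shows "qmat q (\<lambda>a \<alpha>. s a *\<^sub>R z a \<alpha>)"
  unfolding qmat_def
proof (intro allI, goal_cases)
  case (1 a b \<alpha> \<beta>)
  show ?case
    using arg_cong[OF qmatD[OF assms, of a b \<alpha> \<beta>], of "\<lambda>x. (s a * s b) *\<^sub>R x"]
    by (simp add: scaleR_add_right ac_simps)
qed

section \<open>Straightening rules and expansions for quantum minors of row words\<close>

definition nbelow :: "nat set \<Rightarrow> nat \<Rightarrow> nat" where
  "nbelow S x = card {y \<in> S. y < x}"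

definition nabove :: "nat set \<Rightarrow> nat \<Rightarrow> nat" where
  "nabove S x = card {y \<in> S. x < y}"

text \<open>The quantum minor with an arbitrary word of rows and a set of columns, defined by expansion along
  the first row. Admitting unsorted words with repetitions is what makes the straightening rules
  below available.\<close>

primrec qd :: "real \<Rightarrow> (nat \<Rightarrow> nat \<Rightarrow> 'a::real_algebra_1) \<Rightarrow> nat list \<Rightarrow> nat set \<Rightarrow> 'a" where
  "qd q z [] S = (if S = {} then 1 else 0)"
| "qd q z (a # as) S = (\<Sum>x\<in>S. (- q) ^ nbelow S x *\<^sub>R (z a x * qd q z as (S - {x})))"

lemma nbelow_remove:
  assumes "finite S" "x \<in> S"
  shows "nbelow (S - {x}) y = (if x < y then nbelow S y - 1 else nbelow S y)"
proof -
  have "{u \<in> S - {x}. u < y} = (if x < y then {u \<in> S. u < y} - {x} else {u \<in> S. u < y})" by auto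
  then show ?thesis using assms by (simp add: nbelow_def nabove_def)
qed

lemma nabove_remove:
  assumes "finite S" "x \<in> S"
  shows "nabove (S - {x}) y = (if y < x then nabove S y - 1 else nabove S y)"
proof -
  have "{u \<in> S - {x}. y < u} = (if y < x then {u \<in> S. y < u} - {x} else {u \<in> S. y < u})" by auto
  then show ?thesis using assms by (simp add: nbelow_def nabove_def)
qed

lemma nbelow_pos: "finite S \<Longrightarrow> x \<in> S \<Longrightarrow> x < y \<Longrightarrow> 0 < nbelow S y"
  by (auto simp: nbelow_def card_gt_0_iff)

lemma nabove_pos: "finite S \<Longrightarrow> x \<in> S \<Longrightarrow> y < x \<Longrightarrow> 0 < nabove S y"
  by (auto simp: nabove_def card_gt_0_iff)

lemma qd_length_neq_card: "finite S \<Longrightarrow> length as \<noteq> card S \<Longrightarrow> qd q z as S = 0"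
proof (induction as arbitrary: S)
  case (Cons a as)
  have "qd q z as (S - {x}) = 0" if "x \<in> S" for x
  proof (rule Cons.IH)
    show "length as \<noteq> card (S - {x})"
      using card.remove[OF Cons.prems(1) that] Cons.prems(2) by simp
  qed (simp add: Cons.prems)
  then show ?case by simp
qed auto

lemma sum_off_diagonal:
  fixes g :: "nat \<Rightarrow> nat \<Rightarrow> 'a::ab_group_add"
  assumes "finite S"
  shows "(\<Sum>x\<in>S. \<Sum>y\<in>S - {x}. g x y) = (\<Sum>x\<in>S. \<Sum>y\<in>{y \<in> S. x < y}. g x y + g y x)"
proof -
  have 1: "(\<Sum>y\<in>S - {x}. g x y) = (\<Sum>y\<in>{y \<in> S. x < y}. g x y) + (\<Sum>y\<in>{y \<in> S. y < x}. g x y)" for x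
    using assms by (subst sum.union_disjoint[symmetric]) (auto intro!: sum.cong)
  have 2: "(\<Sum>x\<in>S. \<Sum>y\<in>{y \<in> S. y < x}. g x y) = (\<Sum>x\<in>S. \<Sum>y\<in>{y \<in> S. x < y}. g y x)"
    using sum.swap_restrict[OF assms assms, of g "\<lambda>x y. y < x"] by simp
  show ?thesis unfolding 1 sum.distrib 2 ..
qed

lemma sum_swap_off_diagonal:
  fixes g :: "nat \<Rightarrow> nat \<Rightarrow> 'a::ab_group_add"
  assumes "finite S"
  shows "(\<Sum>x\<in>S. \<Sum>y\<in>S - {x}. g x y) = (\<Sum>y\<in>S. \<Sum>x\<in>S - {y}. g x y)"
  unfolding sum_off_diagonal[OF assms] by (simp add: add.commute)

text \<open>Choosing columns \<open>x\<close>, \<open>y\<close> or \<open>y\<close>,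
  \<open>x\<close> for the first two rows leaves the same minor, with weights differing by the
  factor \<open>- q\<close>. Identities for the first two rows are thereby reduced to quantum minors
  of size two.\<close>

lemma qd_two_rows:
  assumes "finite S"
  shows "qd q z (a # b # as) S = (\<Sum>x\<in>S. \<Sum>y\<in>{y \<in> S. x < y}. (- q) ^ (nbelow S x + nbelow S y - 1) *\<^sub>R
     ((z a x * z b y - q *\<^sub>R (z a y * z b x)) * qd q z as (S - {x, y})))"
proof -
  have "qd q z (a # b # as) S = (\<Sum>x\<in>S. \<Sum>y\<in>S - {x}.
      (- q) ^ (nbelow S x + nbelow (S - {x}) y) *\<^sub>R (z a x * z b y * qd q z as (S - {x, y})))"
    by (simp add: sum_distrib_left scaleR_sum_right power_add mult.assoc insert_commute
      flip: Diff_insert)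
  also have "\<dots> = (\<Sum>x\<in>S. \<Sum>y\<in>{y \<in> S. x < y}. (- q) ^ (nbelow S x + nbelow S y - 1) *\<^sub>R
     ((z a x * z b y - q *\<^sub>R (z a y * z b x)) * qd q z as (S - {x, y})))"
    unfolding sum_off_diagonal[OF assms]
  proof (intro sum.cong refl, goal_cases)
    case (1 x y)
    \<comment> \<open>\<open>x\<close> itself lies below \<open>y\<close>, so the subtraction of 1
      on naturals is not truncated.\<close>
    have p: "0 < nbelow S y" using nbelow_pos[OF assms, of x y] 1 by auto
    have e1: "nbelow S x + nbelow (S - {x}) y = nbelow S x + nbelow S y - 1"
      using nbelow_remove[OF assms, of x y] 1 p by auto
    have e2: "nbelow S y + nbelow (S - {y}) x = Suc (nbelow S x + nbelow S y - 1)"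
      using nbelow_remove[OF assms, of y x] 1 p by auto
    show ?case unfolding e1 e2 by (simp add: algebra_simps insert_commute)
  qed
  finally show ?thesis .
qed

lemma qd_equal_rows:
  assumes "qmat q z" "finite S"
  shows "qd q z (a # a # as) S = 0"
  unfolding qd_two_rows[OF assms(2)]
  by (intro sum.neutral ballI) (auto simp: qmat_same_row[OF assms(1)])

lemma qd_swap_rows:
  assumes z: "qmat q z" and "q \<noteq> 0" "finite S" "a < b"
  shows "qd q z (b # a # as) S = - q *\<^sub>R qd q z (a # b # as) S"
  unfolding qd_two_rows[OF assms(3)] scaleR_sum_right
proof (intro sum.cong refl, goal_cases)
  case (1 x y)
  then have xy: "x < y" by simp
  have e: "z b y * z a x = z a x * z b y - (q - 1 / q) *\<^sub>R (z b x * z a y)"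
    using qmat_commute[OF z assms(4) xy] qmat_cross[OF z assms(4) xy] by simp
  have "z b x * z a y - q *\<^sub>R (z b y * z a x) = - q *\<^sub>R (z a x * z b y - q *\<^sub>R (z a y * z b x))"
    unfolding e using assms(2) qmat_commute[OF z assms(4) xy]
    by (simp add: algebra_simps)
  then show ?case by (simp only: mult_scaleR_left scaleR_scaleR mult.commute)
qed

text \<open>Row \<open>a\<close> moves to the right past every smaller row, each exchange costing a
  factor \<open>- q\<close>; if it meets an equal row, the minor vanishes.\<close>

lemma qd_insert_first:
  assumes z: "qmat q z" and q: "q \<noteq> 0"
  shows "finite S \<Longrightarrow> sorted_wrt (<) as \<Longrightarrow> qd q z (a # as) S =
    (if a \<in> set as then 0 else (- q) ^ nbelow (set as) a *\<^sub>R qd q z (insort a as) S)"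
proof (induction as arbitrary: S)
  case (Cons b as)
  consider "a < b" | "a = b" | "b < a" by linarith
  then show ?case
  proof cases
    case 1
    have "nbelow (set (b # as)) a = 0" using 1 Cons.prems(2) by (auto simp: nbelow_def)
    moreover have "a \<notin> set (b # as)" using 1 Cons.prems(2) by auto
    ultimately show ?thesis using 1 by (simp del: qd.simps)
  next
    case 2
    then show ?thesis using qd_equal_rows[OF z Cons.prems(1)] by (simp del: qd.simps)
  next
    case 3
    have "b \<notin> set as" using Cons.prems(2) by auto
    moreover have "{y \<in> set (b # as). y < a} = insert b {y \<in> set as. y < a}" using 3 by auto
    ultimately have c: "nbelow (set (b # as)) a = Suc (nbelow (set as) a)"
      by (simp add: nbelow_def del: set_simps)
    have IH: "qd q z (a # as) (S - {x}) = (if a \<in> set as then 0 else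
        (- q) ^ nbelow (set as) a *\<^sub>R qd q z (insort a as) (S - {x}))" for x
      using Cons by auto
    have "qd q z (a # b # as) S = - q *\<^sub>R qd q z (b # a # as) S"
      by (rule qd_swap_rows[OF z q Cons.prems(1) 3])
    also have "qd q z (b # a # as) S = (if a \<in> set as then 0 else
        (- q) ^ nbelow (set as) a *\<^sub>R qd q z (b # insort a as) S)"
      unfolding qd.simps(2)[of q z b] IH by (simp add: scaleR_sum_right ac_simps del: qd.simps)
    finally show ?thesis using 3 by (simp del: qd.simps set_simps add: c) (simp del: qd.simps)
  qed
qed (simp add: nbelow_def)

lemma qd_last_row:
  "finite S \<Longrightarrow> qd q z (as @ [a]) S = (\<Sum>x\<in>S. (- q) ^ nabove S x *\<^sub>R (qd q z as (S - {x}) * z a x))"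
proof (induction as arbitrary: S)
  case Nil
  show ?case
  proof (cases "card S = 1")
    case True
    then obtain x where "S = {x}" by (auto simp: card_Suc_eq One_nat_def)
    moreover have "nbelow {x} x = 0" "nabove {x} x = 0" by (auto simp: nbelow_def nabove_def)
    ultimately show ?thesis by simp
  next
    case False
    have "S - {x} \<noteq> {}" if "x \<in> S" for x
      using that False by (metis Diff_eq_empty_iff subset_singletonD empty_iff is_singletonI is_singleton_altdef)
    then show ?thesis by simp
  qed
next
  case (Cons b as)
  have "qd q z ((b # as) @ [a]) S = (\<Sum>y\<in>S. \<Sum>x\<in>S - {y}.
      (- q) ^ (nbelow S y + nabove (S - {y}) x) *\<^sub>R (z b y * qd q z as (S - {y} - {x}) * z a x))"
    using Cons by (simp add: sum_distrib_left scaleR_sum_right power_add mult.assoc)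
  also have "\<dots> = (\<Sum>x\<in>S. \<Sum>y\<in>S - {x}.
      (- q) ^ (nbelow S y + nabove (S - {y}) x) *\<^sub>R (z b y * qd q z as (S - {y} - {x}) * z a x))"
    by (rule sum_swap_off_diagonal[OF Cons.prems])
  also have "\<dots> = (\<Sum>x\<in>S. \<Sum>y\<in>S - {x}.
      (- q) ^ (nabove S x + nbelow (S - {x}) y) *\<^sub>R (z b y * qd q z as (S - {x} - {y}) * z a x))"
  proof (intro sum.cong refl, goal_cases)
    case (1 x y)
    \<comment> \<open>If \<open>x < y\<close>, removing either column lowers the count at the other
      by one; if \<open>y < x\<close>, neither count changes.\<close>
    have "nbelow S y + nabove (S - {y}) x = nabove S x + nbelow (S - {x}) y"
      using 1 nbelow_remove[OF Cons.prems, of x y] nabove_remove[OF Cons.prems, of y x]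
        nbelow_pos[OF Cons.prems, of x y] nabove_pos[OF Cons.prems, of y x] by auto
    moreover have "S - {x} - {y} = S - {y} - {x}" by auto
    ultimately show ?case by simp
  qed
  also have "\<dots> = (\<Sum>x\<in>S. (- q) ^ nabove S x *\<^sub>R (qd q z (b # as) (S - {x}) * z a x))"
    by (simp add: sum_distrib_right scaleR_sum_right power_add)
  finally show ?case .
qed

lemma qd_insert_last:
  assumes z: "qmat q z" and q: "q \<noteq> 0"
  shows "finite S \<Longrightarrow> sorted_wrt (<) as \<Longrightarrow> qd q z (as @ [a]) S =
    (if a \<in> set as then 0 else (- q) ^ nabove (set as) a *\<^sub>R qd q z (insort a as) S)"
proof (induction as arbitrary: S)
  case (Cons b as)
  have IH: "qd q z (as @ [a]) (S - {x}) = (if a \<in> set as then 0 else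
      (- q) ^ nabove (set as) a *\<^sub>R qd q z (insort a as) (S - {x}))" for x
    using Cons by auto
  have eq: "qd q z ((b # as) @ [a]) S = (if a \<in> set as then 0 else
      (- q) ^ nabove (set as) a *\<^sub>R qd q z (b # insort a as) S)"
    by (simp add: IH scaleR_sum_right ac_simps)
  have ab: "insort a as = a # as" if "a \<le> b"
    using that Cons.prems(2) by (cases as) auto
  consider "a < b" | "a = b" | "b < a" by linarith
  then show ?case
  proof cases
    case 1
    have "b \<notin> set as" using Cons.prems(2) by auto
    moreover have "{y \<in> set (b # as). a < y} = insert b {y \<in> set as. a < y}" using 1 by auto
    ultimately have c: "nabove (set (b # as)) a = Suc (nabove (set as) a)"
      by (simp add: nabove_def del: set_simps)
    show ?thesis using 1 ab qd_swap_rows[OF z q Cons.prems(1) 1, of as] unfolding eq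
      by (simp del: qd.simps set_simps add: c) (simp del: qd.simps)
  next
    case 2
    then show ?thesis using ab qd_equal_rows[OF z Cons.prems(1)] unfolding eq by (simp del: qd.simps)
  next
    case 3
    have "nabove (set (b # as)) a = nabove (set as) a"
      using 3 unfolding nabove_def by (intro arg_cong[of _ _ card]) auto
    then show ?thesis using 3 unfolding eq by (simp del: qd.simps)
  qed
qed (simp add: nabove_def)

text \<open>An entry to the right of column \<open>x\<close> commutes with the entries of column
  \<open>x\<close> in later rows. After expanding along the first row, the factor from column
  \<open>x\<close> can thus be pulled to the front. The unit lost by \<open>nbelow\<close> when
  column \<open>x\<close> is removed reappears as the unit that the first row adds to the row
  count.\<close>

lemma qd_first_col:
  assumes z: "qmat q z"
  shows "finite S \<Longrightarrow> x \<in> S \<Longrightarrow> (\<And>y. y \<in> S \<Longrightarrow> x \<le> y) \<Longrightarrow> sorted_wrt (<) as \<Longrightarrow>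
    qd q z as S = (\<Sum>a\<in>set as. (- q) ^ nbelow (set as) a *\<^sub>R (z a x * qd q z (remove1 a as) (S - {x})))"
proof (induction as arbitrary: S)
  case (Cons a as)
  have b0: "nbelow S x = 0" using Cons.prems(1,3) by (force simp: nbelow_def)
  have na: "a \<notin> set as" using Cons.prems(4) by auto
  have bx: "nbelow S y = Suc (nbelow (S - {x}) y)" if "y \<in> S - {x}" for y
    using nbelow_remove[OF Cons.prems(1,2), of y] nbelow_pos[OF Cons.prems(1,2), of y] that
      Cons.prems(3)[of y] by auto
  have ba: "nbelow (set (a # as)) b = Suc (nbelow (set as) b)" if "b \<in> set as" for b
  proof -
    have "{y \<in> set (a # as). y < b} = insert a {y \<in> set as. y < b}" using that Cons.prems(4) by auto
    then show ?thesis using na by (simp add: nbelow_def del: set_simps)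
  qed
  have baa: "nbelow (set (a # as)) a = 0" using Cons.prems(4) by (auto simp: nbelow_def)
  have "(\<Sum>y\<in>S - {x}. (- q) ^ nbelow S y *\<^sub>R (z a y * qd q z as (S - {y}))) =
    (\<Sum>y\<in>S - {x}. \<Sum>b\<in>set as. (- q) ^ (Suc (nbelow (set as) b) + nbelow (S - {x}) y) *\<^sub>R
       (z b x * (z a y * qd q z (remove1 b as) (S - {x} - {y}))))"
  proof (intro sum.cong refl, goal_cases)
    case (1 y)
    have IH: "qd q z as (S - {y}) = (\<Sum>b\<in>set as. (- q) ^ nbelow (set as) b *\<^sub>R
        (z b x * qd q z (remove1 b as) (S - {x} - {y})))"
      using Cons.IH[of "S - {y}"] Cons.prems 1 by (auto simp: insert_commute simp flip: Diff_insert)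
    have com: "z a y * (z b x * u) = z b x * (z a y * u)" if "b \<in> set as" for b u
      using qmat_commute[OF z, of a b x y] 1 Cons.prems(3)[of y] Cons.prems(4) that
      by (simp add: mult.assoc[symmetric] order_less_le)
    show ?case unfolding IH using bx[OF 1]
      by (simp add: sum_distrib_left scaleR_sum_right power_add com cong: sum.cong) (simp add: ac_simps)
  qed
  also have "\<dots> = (\<Sum>b\<in>set as. (- q) ^ nbelow (set (a # as)) b *\<^sub>R
      (z b x * qd q z (a # remove1 b as) (S - {x})))"
    by (subst sum.swap) (intro sum.cong refl, simp add: ba sum_distrib_left scaleR_sum_right power_add mult.assoc del: set_simps)
  finally have eq: "(\<Sum>y\<in>S - {x}. (- q) ^ nbelow S y *\<^sub>R (z a y * qd q z as (S - {y}))) =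
     (\<Sum>b\<in>set as. (- q) ^ nbelow (set (a # as)) b *\<^sub>R (z b x * qd q z (remove1 b (a # as)) (S - {x})))"
    using na by (auto intro!: sum.cong simp del: qd.simps)
  have "qd q z (a # as) S = z a x * qd q z as (S - {x}) +
      (\<Sum>y\<in>S - {x}. (- q) ^ nbelow S y *\<^sub>R (z a y * qd q z as (S - {y})))"
    using Cons.prems(1,2) b0 by (simp add: sum.remove[of S x])
  then show ?case unfolding eq using na baa
    by (simp del: qd.simps)
qed auto

abbreviation sl :: "nat set \<Rightarrow> nat list" where "sl \<equiv> sorted_list_of_set"

text \<open>The first-column expansion of one side is the first-row expansion of the other, so
  induction on the number of columns applies.\<close>

lemma qd_transpose:
  assumes z: "qmat q z"
  shows "finite A \<Longrightarrow> finite S \<Longrightarrow> qd q z (sl A) S = qd q (\<lambda>a \<alpha>. z \<alpha> a) (sl S) A"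
proof (induction "card S" arbitrary: A S)
  case 0
  then have "S = {}" by simp
  moreover have "A = {} \<or> sl A \<noteq> []" using 0 by auto
  ultimately show ?case by (cases "sl A") auto
next
  case (Suc k)
  then have ne: "S \<noteq> {}" by auto
  let ?x = "Min S"
  have "qd q z (sl A) S = (\<Sum>a\<in>A. (- q) ^ nbelow A a *\<^sub>R (z a ?x * qd q z (remove1 a (sl A)) (S - {?x})))"
    using qd_first_col[OF z, of S ?x "sl A"] Suc ne by simp
  also have "\<dots> = (\<Sum>a\<in>A. (- q) ^ nbelow A a *\<^sub>R (z a ?x * qd q (\<lambda>a \<alpha>. z \<alpha> a) (sl (S - {?x})) (A - {a})))"
    using Suc ne by (intro sum.cong refl) (simp flip: sorted_list_of_set_remove)
  also have "\<dots> = qd q (\<lambda>a \<alpha>. z \<alpha> a) (sl S) A"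
    using sorted_list_of_set_nonempty[OF Suc.prems(2) ne] by simp
  finally show ?case .
qed

lemma qd_scale_rows: "qd q (\<lambda>a \<alpha>. s a *\<^sub>R z a \<alpha>) as S = (\<Prod>a\<leftarrow>as. s a) *\<^sub>R qd q z as S"
  by (induction as arbitrary: S) (simp_all add: scaleR_sum_right ac_simps)

lemma prod_list_sl: "finite A \<Longrightarrow> (\<Prod>a\<leftarrow>sl A. s a) = prod s A"
  using prod.distinct_set_conv_list[of "sl A" s] by simp

lemma qd_sl_first:
  assumes z: "qmat q z" and q: "q \<noteq> 0" and "finite B" "finite S"
  shows "qd q z (a # sl B) S = (if a \<in> B then 0 else (- q) ^ nbelow B a *\<^sub>R qd q z (sl (insert a B)) S)"
  using qd_insert_first[OF z q assms(4), of "sl B" a] assms(3)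
  by (simp del: qd.simps add: sorted_list_of_set_insert)

lemma qd_sl_last:
  assumes z: "qmat q z" and q: "q \<noteq> 0" and "finite B" "finite S"
  shows "qd q z (sl B @ [a]) S = (if a \<in> B then 0 else (- q) ^ nabove B a *\<^sub>R qd q z (sl (insert a B)) S)"
  using qd_insert_last[OF z q assms(4), of "sl B" a] assms(3)
  by (simp del: qd.simps add: sorted_list_of_set_insert)

section \<open>Laplace expansions\<close>

definition minor :: "real \<Rightarrow> (nat \<Rightarrow> nat \<Rightarrow> 'a::real_algebra_1) \<Rightarrow> nat set \<Rightarrow> nat \<Rightarrow> nat \<Rightarrow> 'a" where
  "minor q z I a \<alpha> = qd q z (sl (I - {a})) (I - {\<alpha>})"

abbreviation det :: "real \<Rightarrow> (nat \<Rightarrow> nat \<Rightarrow> 'a::real_algebra_1) \<Rightarrow> nat set \<Rightarrow> 'a" where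
  "det q z I \<equiv> qd q z (sl I) I"

lemma minor_transpose:
  "qmat q z \<Longrightarrow> finite I \<Longrightarrow> minor q (\<lambda>a \<alpha>. z \<alpha> a) I \<alpha> a = minor q z I a \<alpha>"
  unfolding minor_def by (subst qd_transpose[of q z]) auto

lemma det_transpose: "qmat q z \<Longrightarrow> finite I \<Longrightarrow> det q (\<lambda>a \<alpha>. z \<alpha> a) I = det q z I"
  by (subst qd_transpose[of q z]) auto

text \<open>The sum is the minor with row word \<open>a # sl (I - {b})\<close>. If
  \<open>a \<noteq> b\<close>, row \<open>a\<close> occurs twice and the minor is 0; if
  \<open>a = b\<close>, sorting the word costs the power of \<open>- q\<close> on the right.\<close>

lemma laplace_row_left:
  assumes z: "qmat q z" and q: "q \<noteq> 0" and I: "finite I" "a \<in> I" "b \<in> I"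
  shows "(\<Sum>\<alpha>\<in>I. (- q) ^ nbelow I \<alpha> *\<^sub>R (z a \<alpha> * minor q z I b \<alpha>))
    = (if a = b then (- q) ^ nbelow I b *\<^sub>R det q z I else 0)"
proof -
  have "(\<Sum>\<alpha>\<in>I. (- q) ^ nbelow I \<alpha> *\<^sub>R (z a \<alpha> * minor q z I b \<alpha>)) = qd q z (a # sl (I - {b})) I"
    unfolding minor_def by simp
  then show ?thesis
    using qd_sl_first[OF z q, of "I - {b}" I a] I nbelow_remove[OF I(1,3), of b]
    by (auto simp: insert_absorb simp del: qd.simps)
qed

lemma laplace_row_right:
  assumes z: "qmat q z" and q: "q \<noteq> 0" and I: "finite I" "a \<in> I" "b \<in> I"
  shows "(\<Sum>\<alpha>\<in>I. (- q) ^ nabove I \<alpha> *\<^sub>R (minor q z I b \<alpha> * z a \<alpha>))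
    = (if a = b then (- q) ^ nabove I b *\<^sub>R det q z I else 0)"
proof -
  have "(\<Sum>\<alpha>\<in>I. (- q) ^ nabove I \<alpha> *\<^sub>R (minor q z I b \<alpha> * z a \<alpha>)) = qd q z (sl (I - {b}) @ [a]) I"
    unfolding minor_def using I by (simp add: qd_last_row)
  then show ?thesis
    using qd_sl_last[OF z q, of "I - {b}" I a] I nabove_remove[OF I(1,3), of b]
    by (auto simp: insert_absorb simp del: qd.simps)
qed

lemma laplace_col_right:
  assumes z: "qmat q z" and q: "q \<noteq> 0" and I: "finite I" "\<alpha> \<in> I" "\<beta> \<in> I"
  shows "(\<Sum>a\<in>I. (- q) ^ nabove I a *\<^sub>R (minor q z I a \<beta> * z a \<alpha>))
    = (if \<alpha> = \<beta> then (- q) ^ nabove I \<beta> *\<^sub>R det q z I else 0)"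
  using laplace_row_right[OF qmat_transpose[OF z q] q I]
  by (simp add: minor_transpose[OF z I(1)] det_transpose[OF z I(1)])

section \<open>The inverse of a quantum matrix\<close>

text \<open>The opposite algebra is a type of its own, so that results proved for a type class apply
  verbatim to reversed products.\<close>

datatype 'a op = Op (unop: 'a)

lemma op_eq_iff: "x = y \<longleftrightarrow> unop x = unop y"
  by (cases x; cases y) simp

instantiation op :: (real_algebra_1) real_algebra_1
begin

definition "0 = Op 0"
definition "1 = Op 1"
definition "x + y = Op (unop x + unop y)"
definition "x - y = Op (unop x - unop y)"
definition "- x = Op (- unop x)"
definition "x * y = Op (unop y * unop x)"
definition "r *\<^sub>R x = Op (r *\<^sub>R unop x)"

instance
  by standard (simp_all add: zero_op_def one_op_def plus_op_def minus_op_def uminus_op_def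
    times_op_def scaleR_op_def op_eq_iff algebra_simps)

end

lemma unop_simps [simp]:
  "unop 0 = 0" "unop 1 = 1" "unop (x + y) = unop x + unop y" "unop (x - y) = unop x - unop y"
  "unop (- x) = - unop x" "unop (x * y) = unop y * unop x" "unop (r *\<^sub>R x) = r *\<^sub>R unop x"
  for x y :: "'a::real_algebra_1 op"
  by (simp_all add: zero_op_def one_op_def plus_op_def minus_op_def uminus_op_def times_op_def scaleR_op_def)

lemma unop_sum [simp]: "unop (sum f A) = (\<Sum>x\<in>A. unop (f x))"
  for f :: "_ \<Rightarrow> 'a::real_algebra_1 op"
  by (induction A rule: infinite_finite_induct) simp_all

text \<open>\<open>u\<close> is the transposed inverse: \<open>zu\<close> contracts a common column
  index, \<open>uz\<close> a common row index. The zero values outside \<open>I\<close> are there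
  because \<open>qmat\<close> quantifies over all indices.\<close>

locale qmat_inverse =
  fixes q :: real and I :: "nat set" and z u :: "nat \<Rightarrow> nat \<Rightarrow> 'a::real_algebra_1"
  assumes q: "q \<noteq> 0" and z: "qmat q z" and I: "finite I"
    and u_outside: "a \<notin> I \<or> \<alpha> \<notin> I \<Longrightarrow> u a \<alpha> = 0"
    and zu: "a \<in> I \<Longrightarrow> b \<in> I \<Longrightarrow> (\<Sum>\<alpha>\<in>I. z a \<alpha> * u b \<alpha>) = (if a = b then 1 else 0)"
    and uz: "\<alpha> \<in> I \<Longrightarrow> \<beta> \<in> I \<Longrightarrow> (\<Sum>a\<in>I. u a \<alpha> * z a \<beta>) = (if \<alpha> = \<beta> then 1 else 0)"
begin

lemma zu_contract:
  assumes "a \<in> I" "b \<in> I"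
  shows "(\<Sum>\<alpha>\<in>I. x * z a \<alpha> * u b \<alpha>) = (if a = b then x else 0)"
  using arg_cong[OF zu[OF assms], of "\<lambda>y. x * y"] by (simp add: sum_distrib_left mult.assoc)

lemma uz_contract:
  assumes "\<alpha> \<in> I" "\<beta> \<in> I"
  shows "(\<Sum>a\<in>I. u a \<alpha> * z a \<beta> * x) = (if \<alpha> = \<beta> then x else 0)"
  using arg_cong[OF uz[OF assms], of "\<lambda>y. y * x"] by (simp add: sum_distrib_right)

text \<open>Multiply the defining identity of \<open>z\<close> by \<open>u\<close> on both sides.\<close>

lemma uz_relation:
  assumes "a \<in> I" "c \<in> I" "\<alpha> \<in> I" "\<gamma> \<in> I"
  shows "(if a = c then q else 1) *\<^sub>R (u c \<gamma> * z a \<alpha>)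
      + (if a = c then \<Sum>b\<in>I. (if b < a then q - 1 / q else 0) *\<^sub>R (u b \<gamma> * z b \<alpha>) else 0)
    = (if \<alpha> = \<gamma> then q else 1) *\<^sub>R (z a \<alpha> * u c \<gamma>)
      + (if \<alpha> = \<gamma> then \<Sum>\<beta>\<in>I. (if \<alpha> < \<beta> then q - 1 / q else 0) *\<^sub>R (z a \<beta> * u c \<beta>) else 0)"
proof -
  \<comment> \<open>The left side of the identity is contracted over \<beta> against
    \<open>u c \<beta>\<close>, the right side over \<open>b\<close> against
    \<open>u b \<gamma>\<close>. The coefficients depend only on rows on the left and only on
    columns on the right, so they pass through the contraction as \<open>k\<close>.\<close>
  have L1: "(\<Sum>b\<in>I. \<Sum>\<beta>\<in>I. u b \<gamma> * (k b *\<^sub>R (z a \<alpha> * z b \<beta>)) * u c \<beta>) = k c *\<^sub>R (u c \<gamma> * z a \<alpha>)" for k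
  proof -
    have "(\<Sum>b\<in>I. \<Sum>\<beta>\<in>I. u b \<gamma> * (k b *\<^sub>R (z a \<alpha> * z b \<beta>)) * u c \<beta>)
      = (\<Sum>b\<in>I. k b *\<^sub>R (\<Sum>\<beta>\<in>I. (u b \<gamma> * z a \<alpha>) * z b \<beta> * u c \<beta>))"
      by (simp add: scaleR_sum_right mult.assoc)
    also have "\<dots> = (\<Sum>b\<in>I. if b = c then k b *\<^sub>R (u b \<gamma> * z a \<alpha>) else 0)"
      using assms by (intro sum.cong refl) (simp add: zu_contract)
    finally show ?thesis using I assms by simp
  qed
  have L2: "(\<Sum>b\<in>I. \<Sum>\<beta>\<in>I. u b \<gamma> * (k b *\<^sub>R (z b \<alpha> * z a \<beta>)) * u c \<beta>)
      = (if a = c then \<Sum>b\<in>I. k b *\<^sub>R (u b \<gamma> * z b \<alpha>) else 0)" for k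
  proof -
    have "(\<Sum>b\<in>I. \<Sum>\<beta>\<in>I. u b \<gamma> * (k b *\<^sub>R (z b \<alpha> * z a \<beta>)) * u c \<beta>)
      = (\<Sum>b\<in>I. k b *\<^sub>R (\<Sum>\<beta>\<in>I. (u b \<gamma> * z b \<alpha>) * z a \<beta> * u c \<beta>))"
      by (simp add: scaleR_sum_right mult.assoc)
    then show ?thesis using assms by (simp add: zu_contract)
  qed
  have R1: "(\<Sum>b\<in>I. \<Sum>\<beta>\<in>I. u b \<gamma> * (k \<beta> *\<^sub>R (z b \<beta> * z a \<alpha>)) * u c \<beta>) = k \<gamma> *\<^sub>R (z a \<alpha> * u c \<gamma>)" for k
  proof -
    have "(\<Sum>b\<in>I. \<Sum>\<beta>\<in>I. u b \<gamma> * (k \<beta> *\<^sub>R (z b \<beta> * z a \<alpha>)) * u c \<beta>)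
      = (\<Sum>\<beta>\<in>I. k \<beta> *\<^sub>R (\<Sum>b\<in>I. u b \<gamma> * z b \<beta> * (z a \<alpha> * u c \<beta>)))"
      by (subst sum.swap) (simp add: scaleR_sum_right mult.assoc)
    also have "\<dots> = (\<Sum>\<beta>\<in>I. if \<gamma> = \<beta> then k \<beta> *\<^sub>R (z a \<alpha> * u c \<beta>) else 0)"
      using assms by (intro sum.cong refl) (simp add: uz_contract)
    finally show ?thesis using I assms by simp
  qed
  have R2: "(\<Sum>b\<in>I. \<Sum>\<beta>\<in>I. u b \<gamma> * (k \<beta> *\<^sub>R (z b \<alpha> * z a \<beta>)) * u c \<beta>)
      = (if \<alpha> = \<gamma> then \<Sum>\<beta>\<in>I. k \<beta> *\<^sub>R (z a \<beta> * u c \<beta>) else 0)" for k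
  proof -
    have "(\<Sum>b\<in>I. \<Sum>\<beta>\<in>I. u b \<gamma> * (k \<beta> *\<^sub>R (z b \<alpha> * z a \<beta>)) * u c \<beta>)
      = (\<Sum>\<beta>\<in>I. k \<beta> *\<^sub>R (\<Sum>b\<in>I. u b \<gamma> * z b \<alpha> * (z a \<beta> * u c \<beta>)))"
      by (subst sum.swap) (simp add: scaleR_sum_right mult.assoc)
    then show ?thesis using assms by (simp add: uz_contract)
  qed
  have "(\<Sum>b\<in>I. \<Sum>\<beta>\<in>I. u b \<gamma> * ((if a = b then q else 1) *\<^sub>R (z a \<alpha> * z b \<beta>)
      + (if b < a then q - 1 / q else 0) *\<^sub>R (z b \<alpha> * z a \<beta>)) * u c \<beta>) =
    (\<Sum>b\<in>I. \<Sum>\<beta>\<in>I. u b \<gamma> * ((if \<alpha> = \<beta> then q else 1) *\<^sub>R (z b \<beta> * z a \<alpha>)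
      + (if \<alpha> < \<beta> then q - 1 / q else 0) *\<^sub>R (z b \<alpha> * z a \<beta>)) * u c \<beta>)"
    by (simp only: qmatD[OF z])
  then show ?thesis
    unfolding distrib_left distrib_right sum.distrib L1 L2 R1 R2 .
qed

text \<open>The same double contraction is applied to \<open>uz_relation\<close>. Each term there
  has a single factor \<open>z\<close>, which is absorbed; the inner sums collapse together with
  it.\<close>

lemma uu_relation:
  assumes "a \<in> I" "b \<in> I" "\<alpha> \<in> I" "\<beta> \<in> I"
  shows "(if a = b then q else 1) *\<^sub>R (u b \<beta> * u a \<alpha>) + (if b < a then q - 1 / q else 0) *\<^sub>R (u a \<beta> * u b \<alpha>)
   = (if \<alpha> = \<beta> then q else 1) *\<^sub>R (u a \<alpha> * u b \<beta>) + (if \<alpha> < \<beta> then q - 1 / q else 0) *\<^sub>R (u a \<beta> * u b \<alpha>)"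
proof -
  have L1: "(\<Sum>c\<in>I. \<Sum>\<gamma>\<in>I. u c \<beta> * (k c *\<^sub>R (u a \<alpha> * z c \<gamma>)) * u b \<gamma>) = k b *\<^sub>R (u b \<beta> * u a \<alpha>)" for k
  proof -
    have "(\<Sum>c\<in>I. \<Sum>\<gamma>\<in>I. u c \<beta> * (k c *\<^sub>R (u a \<alpha> * z c \<gamma>)) * u b \<gamma>)
      = (\<Sum>c\<in>I. k c *\<^sub>R (\<Sum>\<gamma>\<in>I. (u c \<beta> * u a \<alpha>) * z c \<gamma> * u b \<gamma>))"
      by (simp add: scaleR_sum_right mult.assoc)
    also have "\<dots> = (\<Sum>c\<in>I. if c = b then k c *\<^sub>R (u c \<beta> * u a \<alpha>) else 0)"
      using assms by (intro sum.cong refl) (simp add: zu_contract)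
    finally show ?thesis using I assms by simp
  qed
  have L2: "(\<Sum>c\<in>I. \<Sum>\<gamma>\<in>I. u c \<beta> * (if c = a then \<Sum>d\<in>I. k c d *\<^sub>R (u d \<alpha> * z d \<gamma>) else 0) * u b \<gamma>)
      = k a b *\<^sub>R (u a \<beta> * u b \<alpha>)" for k
  proof -
    have "(\<Sum>c\<in>I. \<Sum>\<gamma>\<in>I. u c \<beta> * (if c = a then \<Sum>d\<in>I. k c d *\<^sub>R (u d \<alpha> * z d \<gamma>) else 0) * u b \<gamma>)
      = (\<Sum>c\<in>I. if c = a then \<Sum>\<gamma>\<in>I. u c \<beta> * (\<Sum>d\<in>I. k c d *\<^sub>R (u d \<alpha> * z d \<gamma>)) * u b \<gamma> else 0)"
      by (intro sum.cong refl) auto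
    also have "\<dots> = (\<Sum>\<gamma>\<in>I. \<Sum>d\<in>I. k a d *\<^sub>R ((u a \<beta> * u d \<alpha>) * z d \<gamma> * u b \<gamma>))"
      using I assms by (simp add: sum_distrib_left sum_distrib_right mult.assoc)
    also have "\<dots> = (\<Sum>d\<in>I. k a d *\<^sub>R (\<Sum>\<gamma>\<in>I. (u a \<beta> * u d \<alpha>) * z d \<gamma> * u b \<gamma>))"
      by (subst sum.swap) (simp add: scaleR_sum_right)
    also have "\<dots> = (\<Sum>d\<in>I. if d = b then k a d *\<^sub>R (u a \<beta> * u d \<alpha>) else 0)"
      using assms by (intro sum.cong refl) (simp add: zu_contract)
    finally show ?thesis using I assms by simp
  qed
  have R1: "(\<Sum>c\<in>I. \<Sum>\<gamma>\<in>I. u c \<beta> * (k \<gamma> *\<^sub>R (z c \<gamma> * u a \<alpha>)) * u b \<gamma>) = k \<beta> *\<^sub>R (u a \<alpha> * u b \<beta>)" for k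
  proof -
    have "(\<Sum>c\<in>I. \<Sum>\<gamma>\<in>I. u c \<beta> * (k \<gamma> *\<^sub>R (z c \<gamma> * u a \<alpha>)) * u b \<gamma>)
      = (\<Sum>\<gamma>\<in>I. k \<gamma> *\<^sub>R (\<Sum>c\<in>I. u c \<beta> * z c \<gamma> * (u a \<alpha> * u b \<gamma>)))"
      by (subst sum.swap) (simp add: scaleR_sum_right mult.assoc)
    also have "\<dots> = (\<Sum>\<gamma>\<in>I. if \<beta> = \<gamma> then k \<gamma> *\<^sub>R (u a \<alpha> * u b \<gamma>) else 0)"
      using assms by (intro sum.cong refl) (simp add: uz_contract)
    finally show ?thesis using I assms by simp
  qed
  have R2: "(\<Sum>c\<in>I. \<Sum>\<gamma>\<in>I. u c \<beta> * (if \<gamma> = \<alpha> then \<Sum>\<delta>\<in>I. k \<gamma> \<delta> *\<^sub>R (z c \<delta> * u a \<delta>) else 0) * u b \<gamma>)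
      = k \<alpha> \<beta> *\<^sub>R (u a \<beta> * u b \<alpha>)" for k
  proof -
    have "(\<Sum>c\<in>I. \<Sum>\<gamma>\<in>I. u c \<beta> * (if \<gamma> = \<alpha> then \<Sum>\<delta>\<in>I. k \<gamma> \<delta> *\<^sub>R (z c \<delta> * u a \<delta>) else 0) * u b \<gamma>)
      = (\<Sum>c\<in>I. \<Sum>\<gamma>\<in>I. if \<gamma> = \<alpha> then u c \<beta> * (\<Sum>\<delta>\<in>I. k \<gamma> \<delta> *\<^sub>R (z c \<delta> * u a \<delta>)) * u b \<gamma> else 0)"
      by (intro sum.cong refl) auto
    also have "\<dots> = (\<Sum>c\<in>I. \<Sum>\<delta>\<in>I. k \<alpha> \<delta> *\<^sub>R (u c \<beta> * z c \<delta> * (u a \<delta> * u b \<alpha>)))"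
      using I assms by (simp add: sum_distrib_left sum_distrib_right mult.assoc)
    also have "\<dots> = (\<Sum>\<delta>\<in>I. k \<alpha> \<delta> *\<^sub>R (\<Sum>c\<in>I. u c \<beta> * z c \<delta> * (u a \<delta> * u b \<alpha>)))"
      by (subst sum.swap) (simp add: scaleR_sum_right)
    also have "\<dots> = (\<Sum>\<delta>\<in>I. if \<beta> = \<delta> then k \<alpha> \<delta> *\<^sub>R (u a \<delta> * u b \<alpha>) else 0)"
      using assms by (intro sum.cong refl) (simp add: uz_contract)
    finally show ?thesis using I assms by simp
  qed
  have "(\<Sum>c\<in>I. \<Sum>\<gamma>\<in>I. u c \<beta> * ((if c = a then q else 1) *\<^sub>R (u a \<alpha> * z c \<gamma>)
      + (if c = a then \<Sum>d\<in>I. (if d < c then q - 1 / q else 0) *\<^sub>R (u d \<alpha> * z d \<gamma>) else 0)) * u b \<gamma>) =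
    (\<Sum>c\<in>I. \<Sum>\<gamma>\<in>I. u c \<beta> * ((if \<gamma> = \<alpha> then q else 1) *\<^sub>R (z c \<gamma> * u a \<alpha>)
      + (if \<gamma> = \<alpha> then \<Sum>\<delta>\<in>I. (if \<gamma> < \<delta> then q - 1 / q else 0) *\<^sub>R (z c \<delta> * u a \<delta>) else 0)) * u b \<gamma>)"
    using assms by (intro sum.cong refl) (simp only: uz_relation)
  then show ?thesis
    unfolding distrib_left distrib_right sum.distrib L1 L2 R1 R2 by (simp only: eq_commute)
qed

lemma qmat_op_u: "qmat q (\<lambda>a \<alpha>. Op (u a \<alpha>))"
  unfolding qmat_def
proof (intro allI, goal_cases)
  case (1 a b \<alpha> \<beta>)
  show ?case
  proof (cases "a \<in> I \<and> b \<in> I \<and> \<alpha> \<in> I \<and> \<beta> \<in> I")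
    case True
    then show ?thesis using uu_relation[of a b \<alpha> \<beta>] by (simp add: op_eq_iff)
  next
    case False
    then show ?thesis using u_outside by (auto simp: op_eq_iff)
  qed
qed

text \<open>A Cauchy--Binet formula for the product of \<open>z\<close> with its inverse, proved one column at a time:
  contracting a row of \<open>u\<close> with the first row of a minor of \<open>z\<close> removes that row.\<close>

lemma sum_minors_eq_1:
  "sorted_wrt (<) ks \<Longrightarrow> set ks \<subseteq> I \<Longrightarrow>
    (\<Sum>A\<in>Pow I. unop (qd q (\<lambda>k a. Op (u a k)) ks A) * qd q z (sl A) (set ks)) = 1"
proof (induction ks)
  case Nil
  have "unop (qd q (\<lambda>k a. Op (u a k)) [] A) * qd q z (sl A) (set []) = (if A = {} then 1 else 0)" for A
    by (cases "A = {}") auto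
  then show ?case using I by simp
next
  case (Cons k ks)
  let ?E = "\<lambda>A. unop (qd q (\<lambda>k a. Op (u a k)) ks A)"
  let ?K = "insert k (set ks)"
  have fin: "finite A" if "A \<in> Pow I" for A using that I by (auto intro: finite_subset)
  have "(\<Sum>A\<in>Pow I. unop (qd q (\<lambda>k a. Op (u a k)) (k # ks) A) * qd q z (sl A) ?K)
    = (\<Sum>A\<in>Pow I. \<Sum>a\<in>A. ?E (A - {a}) * ((- q) ^ nbelow A a *\<^sub>R (u a k * qd q z (sl A) ?K)))"
    by (simp add: sum_distrib_right mult.assoc)
  also have "\<dots> = (\<Sum>(A, a)\<in>Sigma (Pow I) (\<lambda>A. A). ?E (A - {a}) * ((- q) ^ nbelow A a *\<^sub>R (u a k * qd q z (sl A) ?K)))"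
    using I fin by (subst sum.Sigma) auto
  also have "\<dots> = (\<Sum>(B, a)\<in>Sigma (Pow I) (\<lambda>B. I - B).
      ?E B * ((- q) ^ nbelow B a *\<^sub>R (u a k * qd q z (sl (insert a B)) ?K)))"
  \<comment> \<open>A set \<open>A\<close> with a chosen element \<open>a\<close> is exchanged for
    \<open>B = A - {a}\<close> and a row outside \<open>B\<close>, so that the weight becomes the
    cost of sorting \<open>a # sl B\<close>.\<close>
  proof (rule sum.reindex_bij_witness[where i = "\<lambda>(B, a). (insert a B, a)" and j = "\<lambda>(A, a). (A - {a}, a)"], goal_cases)
    case (5 x)
    then obtain A a where x: "x = (A, a)" "A \<in> Pow I" "a \<in> A" by auto
    have "insort a (sl (A - {a})) = sl A"
      using fin[OF x(2)] x(3) by (metis Diff_iff finite_Diff insert_Diff singletonI sorted_list_of_set_insert)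
    then show ?case using x fin[of A] nbelow_remove[of A a a] by (simp add: insert_absorb)
  qed (auto simp: insert_absorb)
  also have "\<dots> = (\<Sum>B\<in>Pow I. \<Sum>a\<in>I - B. ?E B * ((- q) ^ nbelow B a *\<^sub>R (u a k * qd q z (sl (insert a B)) ?K)))"
    using I by (subst sum.Sigma) auto
  also have "\<dots> = (\<Sum>B\<in>Pow I. ?E B * qd q z (sl B) (set ks))"
  proof (intro sum.cong refl)
    fix B assume B: "B \<in> Pow I"
    have "(\<Sum>a\<in>I - B. ?E B * ((- q) ^ nbelow B a *\<^sub>R (u a k * qd q z (sl (insert a B)) ?K)))
      = (\<Sum>a\<in>I - B. ?E B * (u a k * qd q z (a # sl B) ?K))"
      using fin[OF B] by (intro sum.cong refl) (simp add: qd_sl_first[OF z q] del: qd.simps)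
    \<comment> \<open>For \<open>a \<in> B\<close> the minor has a repeated row, so the sum may run
      over all of \<open>I\<close>, as contraction with \<open>u\<close> requires.\<close>
    also have "\<dots> = (\<Sum>a\<in>I. ?E B * (u a k * qd q z (a # sl B) ?K))"
      using fin[OF B] I B
      by (intro sum.mono_neutral_left) (auto simp: qd_sl_first[OF z q] simp del: qd.simps)
    also have "\<dots> = (\<Sum>x\<in>?K. ?E B * ((- q) ^ nbelow ?K x *\<^sub>R (\<Sum>a\<in>I. u a k * z a x * qd q z (sl B) (?K - {x}))))"
      unfolding qd.simps sum_distrib_left scaleR_sum_right
      by (subst sum.swap) (simp add: mult.assoc)
    also have "\<dots> = (\<Sum>x\<in>?K. if k = x then ?E B * ((- q) ^ nbelow ?K x *\<^sub>R qd q z (sl B) (?K - {x})) else 0)"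
    proof (intro sum.cong refl, goal_cases)
      case (1 x)
      then have "k \<in> I" "x \<in> I" using Cons.prems by auto
      then show ?case by (simp add: uz_contract)
    qed
    also have "\<dots> = ?E B * ((- q) ^ nbelow ?K k *\<^sub>R qd q z (sl B) (?K - {k}))" by simp
    \<comment> \<open>\<open>k\<close> is the least of the columns because the list is sorted, so
      the surviving term has weight 1.\<close>
    also have "nbelow ?K k = 0" using Cons.prems(1) by (auto simp: nbelow_def)
    also have "?K - {k} = set ks" using Cons.prems(1) by auto
    finally show "(\<Sum>a\<in>I - B. ?E B * ((- q) ^ nbelow B a *\<^sub>R (u a k * qd q z (sl (insert a B)) ?K)))
      = ?E B * qd q z (sl B) (set ks)" by simp
  qed
  also have "\<dots> = 1" using Cons by simp
  finally show ?case by simp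
qed

text \<open>With all columns of \<open>I\<close> selected, only the row set \<open>A = I\<close> has
  the right size to contribute to the Cauchy-Binet sum.\<close>

lemma det_u_det_z: "unop (det q (\<lambda>a \<alpha>. Op (u a \<alpha>)) I) * det q z I = 1"
proof -
  have "qd q z (sl A) I = 0" if "A \<in> Pow I - {I}" for A
    using that I card_subset_eq[of I A] by (intro qd_length_neq_card) auto
  then have "(\<Sum>A\<in>Pow I. unop (qd q (\<lambda>k a. Op (u a k)) (sl I) A) * qd q z (sl A) I)
     = unop (det q (\<lambda>k a. Op (u a k)) I) * det q z I"
    using I by (subst sum.remove[of _ I]) auto
  then show ?thesis
    using sum_minors_eq_1[of "sl I"] I det_transpose[OF qmat_op_u I] by simp
qed

text \<open>Laplace expansion in the opposite algebra says that the minors of \<open>u\<close>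
  multiplied by \<open>u\<close> give its determinant. Multiplying on the right by \<open>z\<close>
  cancels \<open>u\<close> and isolates one minor.\<close>

lemma minor_u:
  assumes "b \<in> I" "\<gamma> \<in> I"
  shows "(- q) ^ nbelow I \<gamma> *\<^sub>R unop (minor q (\<lambda>a \<alpha>. Op (u a \<alpha>)) I b \<gamma>)
    = (- q) ^ nbelow I b *\<^sub>R (unop (det q (\<lambda>a \<alpha>. Op (u a \<alpha>)) I) * z b \<gamma>)"
proof -
  let ?M = "\<lambda>\<alpha>. unop (minor q (\<lambda>a \<alpha>. Op (u a \<alpha>)) I b \<alpha>)"
  let ?D = "unop (det q (\<lambda>a \<alpha>. Op (u a \<alpha>)) I)"
  have L: "(\<Sum>\<alpha>\<in>I. (- q) ^ nbelow I \<alpha> *\<^sub>R (?M \<alpha> * u a \<alpha>))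
      = (if a = b then (- q) ^ nbelow I b *\<^sub>R ?D else 0)" if "a \<in> I" for a
    using arg_cong[OF laplace_row_left[OF qmat_op_u q I that assms(1)], of unop] by simp
  have "(- q) ^ nbelow I \<gamma> *\<^sub>R ?M \<gamma> = (\<Sum>\<alpha>\<in>I. if \<alpha> = \<gamma> then (- q) ^ nbelow I \<alpha> *\<^sub>R ?M \<alpha> else 0)"
    using I assms by simp
  also have "\<dots> = (\<Sum>\<alpha>\<in>I. \<Sum>a\<in>I. (- q) ^ nbelow I \<alpha> *\<^sub>R (?M \<alpha> * u a \<alpha>) * z a \<gamma>)"
    using assms by (intro sum.cong refl) (simp add: mult.assoc uz flip: scaleR_sum_right sum_distrib_left)
  also have "\<dots> = (\<Sum>a\<in>I. (if a = b then (- q) ^ nbelow I b *\<^sub>R ?D else 0) * z a \<gamma>)"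
    by (subst sum.swap) (simp only: sum_distrib_right[symmetric] L cong: sum.cong)
  also have "\<dots> = (\<Sum>a\<in>I. if a = b then (- q) ^ nbelow I b *\<^sub>R ?D * z a \<gamma> else 0)"
    by (intro sum.cong refl) auto
  finally show ?thesis using I assms by simp
qed

end

section \<open>The adjoint matrix over the localized algebra\<close>

lemma nbelow_interval: "\<alpha> \<in> {1..n} \<Longrightarrow> nbelow {1..n} \<alpha> = \<alpha> - 1"
proof -
  assume "\<alpha> \<in> {1..n}"
  then have "{y \<in> {1..n}. y < \<alpha>} = {1..<\<alpha>}" by auto
  then show ?thesis by (simp add: nbelow_def)
qed

lemma nabove_interval: "nabove {1..n} \<alpha> = n - \<alpha>" if "1 \<le> \<alpha>"
proof -
  have "{y \<in> {1..n}. \<alpha> < y} = {\<alpha><..n}" using that by auto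
  then show ?thesis by (simp add: nabove_def)
qed

locale qgl =
  fixes q :: real and n :: nat and I :: "nat set" and z :: "nat \<Rightarrow> nat \<Rightarrow> 'a::real_algebra_1" and T :: 'a
  assumes I_eq: "I = {1..n}" and q: "q \<noteq> 0" and z: "qmat q z"
    and T_det: "T * det q z I = 1" and det_T: "det q z I * T = 1"
begin

lemma finite_I [simp]: "finite I"
  by (simp add: I_eq)

lemma mem_I: "a \<in> I \<longleftrightarrow> 1 \<le> a \<and> a \<le> n"
  by (auto simp: I_eq)

abbreviation "\<Delta> \<equiv> det q z I"

text \<open>On \<open>I\<close> the exponent equals both
  \<open>nbelow I \<alpha> - nbelow I a\<close> and \<open>nabove I a - nabove I \<alpha>\<close>,
  taken as integers. One matrix therefore serves the row expansion on one side and the column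
  expansion on the other.\<close>

definition adj :: "nat \<Rightarrow> nat \<Rightarrow> 'a" where
  "adj a \<alpha> = (- q) powi (int \<alpha> - int a) *\<^sub>R minor q z I a \<alpha>"

text \<open>\<open>u\<close> is the transpose of the inverse matrix of \<open>z\<close>. The adjoint matrix \<open>w\<close> of the theorem
  differs from it by a row scaling.\<close>

definition u :: "nat \<Rightarrow> nat \<Rightarrow> 'a" where
  "u a \<alpha> = (if a \<in> I \<and> \<alpha> \<in> I then T * adj a \<alpha> else 0)"

text \<open>The quotient of the prescribed coefficient with exponent
  \<open>a + \<alpha> - 2n\<close> by the Laplace coefficient with exponent
  \<open>\<alpha> - a\<close>; it depends on the row alone.\<close>

definition s :: "nat \<Rightarrow> real" where
  "s a = (- q) powi (2 * int a - 2 * int n)"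

definition w :: "nat \<Rightarrow> nat \<Rightarrow> 'a" where
  "w a \<alpha> = s a *\<^sub>R u a \<alpha>"

lemma s_nonzero: "s a \<noteq> 0"
  using q by (simp add: s_def)

lemma w_eq: "w a \<alpha> = (if a \<in> I \<and> \<alpha> \<in> I
    then (- q) powi (int a + int \<alpha> - 2 * int n) *\<^sub>R (T * minor q z I a \<alpha>) else 0)"
proof -
  have "(- q) powi (2 * int a - 2 * int n) * (- q) powi (int \<alpha> - int a)
      = (- q) powi (int a + int \<alpha> - 2 * int n)"
    using q by (subst power_int_add[symmetric]) (auto intro!: arg_cong2[of _ _ _ _ "(powi)"])
  then show ?thesis unfolding w_def u_def adj_def s_def by simp
qed

lemma powi_diff_nbelow:
  assumes "a \<in> I" "b \<in> I"
  shows "(- q) powi (int a - int b) = (- q) ^ nbelow I a / (- q) ^ nbelow I b"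
proof -
  have e: "int a - int b = int (a - 1) - int (b - 1)" using assms by (auto simp: mem_I)
  have "nbelow I a = a - 1" "nbelow I b = b - 1"
    using assms unfolding I_eq by (simp_all only: nbelow_interval)
  then show ?thesis using q unfolding e by (simp add: power_int_diff)
qed

lemma powi_diff_nabove:
  assumes "a \<in> I" "b \<in> I"
  shows "(- q) powi (int a - int b) = (- q) ^ nabove I b / (- q) ^ nabove I a"
proof -
  have e: "int a - int b = int (n - b) - int (n - a)" using assms by (auto simp: mem_I)
  have "nabove I a = n - a" "nabove I b = n - b"
    using assms nabove_interval[of a n] nabove_interval[of b n] by (simp_all only: mem_I flip: I_eq)
  then show ?thesis using q unfolding e by (simp add: power_int_diff)
qed

lemma z_adj:
  assumes "a \<in> I" "b \<in> I"
  shows "(\<Sum>\<alpha>\<in>I. z a \<alpha> * adj b \<alpha>) = (if a = b then \<Delta> else 0)"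
proof -
  have "(- q) powi (int \<alpha> - int b) = (- q) ^ nbelow I \<alpha> / (- q) ^ nbelow I b" if "\<alpha> \<in> I" for \<alpha>
    using powi_diff_nbelow[OF that assms(2)] .
  then have "(\<Sum>\<alpha>\<in>I. z a \<alpha> * adj b \<alpha>) =
      (1 / (- q) ^ nbelow I b) *\<^sub>R (\<Sum>\<alpha>\<in>I. (- q) ^ nbelow I \<alpha> *\<^sub>R (z a \<alpha> * minor q z I b \<alpha>))"
    unfolding adj_def scaleR_sum_right by (intro sum.cong refl) simp
  then show ?thesis using laplace_row_left[OF z q _ assms] q by simp
qed

lemma adj_z:
  assumes "\<alpha> \<in> I" "\<beta> \<in> I"
  shows "(\<Sum>a\<in>I. adj a \<alpha> * z a \<beta>) = (if \<alpha> = \<beta> then \<Delta> else 0)"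
proof -
  have "(- q) powi (int \<alpha> - int a) = (- q) ^ nabove I a / (- q) ^ nabove I \<alpha>" if "a \<in> I" for a
    using powi_diff_nabove[OF assms(1) that] .
  then have "(\<Sum>a\<in>I. adj a \<alpha> * z a \<beta>) =
      (1 / (- q) ^ nabove I \<alpha>) *\<^sub>R (\<Sum>a\<in>I. (- q) ^ nabove I a *\<^sub>R (minor q z I a \<alpha> * z a \<beta>))"
    unfolding adj_def scaleR_sum_right by (intro sum.cong refl) simp
  then show ?thesis using laplace_col_right[OF z q _ assms(2,1)] q by auto
qed

text \<open>The triple product of \<open>z\<close>, the transpose of \<open>adj\<close> and
  \<open>z\<close> is bracketed in two ways; one gives \<open>z * \<Delta>\<close>, the other
  \<open>\<Delta> * z\<close>.\<close>

lemma det_central: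
  assumes "a \<in> I" "\<beta> \<in> I"
  shows "z a \<beta> * \<Delta> = \<Delta> * z a \<beta>"
proof -
  have "z a \<beta> * \<Delta> = (\<Sum>\<alpha>\<in>I. if \<alpha> = \<beta> then z a \<alpha> * \<Delta> else 0)" using assms by simp
  also have "\<dots> = (\<Sum>\<alpha>\<in>I. z a \<alpha> * (\<Sum>b\<in>I. adj b \<alpha> * z b \<beta>))"
    using assms by (intro sum.cong refl) (simp only: adj_z, simp)
  also have "\<dots> = (\<Sum>b\<in>I. (\<Sum>\<alpha>\<in>I. z a \<alpha> * adj b \<alpha>) * z b \<beta>)"
    unfolding sum_distrib_left sum_distrib_right by (subst sum.swap) (simp only: mult.assoc)
  also have "\<dots> = (\<Sum>b\<in>I. if b = a then \<Delta> * z b \<beta> else 0)"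
    using assms by (intro sum.cong refl) (simp only: z_adj, simp)
  also have "\<dots> = \<Delta> * z a \<beta>" using assms by simp
  finally show ?thesis .
qed

lemma T_central:
  assumes "a \<in> I" "\<beta> \<in> I"
  shows "T * z a \<beta> = z a \<beta> * T"
proof -
  have "T * z a \<beta> = T * (z a \<beta> * \<Delta>) * T" by (simp only: mult.assoc det_T mult_1_right)
  also have "\<dots> = T * \<Delta> * (z a \<beta> * T)" by (simp only: det_central[OF assms] mult.assoc)
  finally show ?thesis by (simp only: T_det mult_1_left)
qed

sublocale qmat_inverse q I z u
proof
  fix a b assume ab: "a \<in> I" "b \<in> I"
  have "(\<Sum>\<alpha>\<in>I. z a \<alpha> * u b \<alpha>) = (\<Sum>\<alpha>\<in>I. T * (z a \<alpha> * adj b \<alpha>))"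
    unfolding u_def using ab T_central[OF ab(1)] by (intro sum.cong refl) (simp flip: mult.assoc)
  also have "\<dots> = (if a = b then 1 else 0)"
    unfolding sum_distrib_left[symmetric] z_adj[OF ab] using T_det by simp
  finally show "(\<Sum>\<alpha>\<in>I. z a \<alpha> * u b \<alpha>) = (if a = b then 1 else 0)" .
next
  fix \<alpha> \<beta> assume ab: "\<alpha> \<in> I" "\<beta> \<in> I"
  have "(\<Sum>a\<in>I. u a \<alpha> * z a \<beta>) = (\<Sum>a\<in>I. T * (adj a \<alpha> * z a \<beta>))"
    unfolding u_def using ab by (intro sum.cong refl) (simp add: mult.assoc)
  also have "\<dots> = (if \<alpha> = \<beta> then 1 else 0)"
    unfolding sum_distrib_left[symmetric] adj_z[OF ab] using T_det by simp
  finally show "(\<Sum>a\<in>I. u a \<alpha> * z a \<beta>) = (if \<alpha> = \<beta> then 1 else 0)" .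
qed (use q z in \<open>auto simp: u_def\<close>)

lemma qmat_op_w: "qmat q (\<lambda>a \<alpha>. Op (w a \<alpha>))"
proof -
  have "(\<lambda>a \<alpha>. Op (w a \<alpha>)) = (\<lambda>a \<alpha>. s a *\<^sub>R Op (u a \<alpha>))"
    by (simp add: w_def op_eq_iff fun_eq_iff)
  then show ?thesis using qmat_scale_rows[OF qmat_op_u, of s] by simp
qed

lemma det_u: "unop (det q (\<lambda>a \<alpha>. Op (u a \<alpha>)) I) = T"
proof -
  have "unop (det q (\<lambda>a \<alpha>. Op (u a \<alpha>)) I) = unop (det q (\<lambda>a \<alpha>. Op (u a \<alpha>)) I) * (\<Delta> * T)"
    by (simp add: det_T)
  then show ?thesis unfolding mult.assoc[symmetric] det_u_det_z by simp
qed

lemma qd_op_w: "unop (qd q (\<lambda>a \<alpha>. Op (w a \<alpha>)) as S) = (\<Prod>a\<leftarrow>as. s a) *\<^sub>R unop (qd q (\<lambda>a \<alpha>. Op (u a \<alpha>)) as S)"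
proof -
  have "(\<lambda>a \<alpha>. Op (w a \<alpha>)) = (\<lambda>a \<alpha>. s a *\<^sub>R Op (u a \<alpha>))"
    by (simp add: w_def op_eq_iff fun_eq_iff)
  then show ?thesis by (simp add: qd_scale_rows)
qed

lemma det_w: "unop (det q (\<lambda>a \<alpha>. Op (w a \<alpha>)) I) = prod s I *\<^sub>R T"
  by (simp add: qd_op_w det_u prod_list_sl)

text \<open>The left side is the adjoint of \<open>w b \<gamma>\<close>: the coefficient is real,
  the minor becomes one of \<open>w\<close> with reversed products, and \<open>T\<close> becomes
  \<open>\<Delta>\<close> divided by \<open>prod s I\<close>. This is the computation behind
  \<open>z** = z\<close>.\<close>

lemma minor_w:
  assumes "b \<in> I" "\<gamma> \<in> I"
  shows "(- q) powi (int b + int \<gamma> - 2 * int n) *\<^sub>R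
    (unop (minor q (\<lambda>a \<alpha>. Op (w a \<alpha>)) I b \<gamma>) * ((1 / prod s I) *\<^sub>R \<Delta>)) = z b \<gamma>"
proof -
  let ?M = "unop (minor q (\<lambda>a \<alpha>. Op (u a \<alpha>)) I b \<gamma>)"
  have M: "?M = (- q) powi (int b - int \<gamma>) *\<^sub>R (T * z b \<gamma>)"
    using arg_cong[OF minor_u[OF assms], of "\<lambda>x. (1 / (- q) ^ nbelow I \<gamma>) *\<^sub>R x"] q
    by (simp add: det_u powi_diff_nbelow[OF assms])
  let ?c = "(- q) powi (int b + int \<gamma> - 2 * int n)" and ?d = "(- q) powi (int b - int \<gamma>)"
  let ?P = "prod s (I - {b})"
  have w: "unop (minor q (\<lambda>a \<alpha>. Op (w a \<alpha>)) I b \<gamma>) = ?P *\<^sub>R ?M"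
    unfolding minor_def qd_op_w by (simp add: prod_list_sl)
  have P: "prod s I = s b * ?P" using assms by (simp add: prod.remove)
  have z': "T * z b \<gamma> * \<Delta> = z b \<gamma>"
    by (simp only: mult.assoc det_central[OF assms]) (simp only: T_det mult_1_left flip: mult.assoc)
  \<comment> \<open>The minor omits row \<open>b\<close>, so its scaling lacks exactly the factor
    \<open>s b\<close> of \<open>prod s I\<close>; the two powers of \<open>- q\<close> supply
    it.\<close>
  have "?c * ?d = s b"
    unfolding s_def using q by (subst power_int_add[symmetric]) (auto intro!: arg_cong2[of _ _ _ _ "(powi)"])
  moreover have "?P \<noteq> 0" using s_nonzero by simp
  ultimately have c: "?c * (1 / prod s I * (?P * ?d)) = 1"
    using s_nonzero[of b] unfolding P by (simp add: field_simps)
  have "?c *\<^sub>R (unop (minor q (\<lambda>a \<alpha>. Op (w a \<alpha>)) I b \<gamma>) * ((1 / prod s I) *\<^sub>R \<Delta>))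
      = (?c * (1 / prod s I * (?P * ?d))) *\<^sub>R (T * z b \<gamma> * \<Delta>)"
    unfolding w M by (simp only: mult_scaleR_left mult_scaleR_right scaleR_scaleR mult.assoc)
  then show ?thesis unfolding c z' by simp
qed

section \<open>Commutation of the matrix with its adjoint\<close>

lemma sum_if_scaleR:
  fixes F :: "nat \<Rightarrow> 'b::real_vector"
  shows "(\<Sum>x\<in>I. (if P x then c else 0) *\<^sub>R F x) = c *\<^sub>R sum F {x \<in> I. P x}"
  unfolding scaleR_sum_right by (subst sum.inter_filter) (auto intro!: sum.cong)

lemma w_z_neq:
  assumes "a \<in> I" "b \<in> I" "\<alpha> \<in> I" "\<beta> \<in> I" "a \<noteq> b"
  shows "w b \<beta> * z a \<alpha> = (if \<alpha> = \<beta> then q *\<^sub>R (z a \<alpha> * w b \<alpha>) + (q - 1 / q) *\<^sub>R (\<Sum>\<gamma>\<in>{\<gamma>\<in>I. \<alpha> < \<gamma>}. z a \<gamma> * w b \<gamma>)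
    else z a \<alpha> * w b \<beta>)"
proof -
  note R = uz_relation[OF assms(1,2,3,4), unfolded sum_if_scaleR]
  have e: "(\<Sum>\<gamma>\<in>{\<gamma>\<in>I. \<alpha> < \<gamma>}. z a \<gamma> * w b \<gamma>) = s b *\<^sub>R (\<Sum>\<gamma>\<in>{\<gamma>\<in>I. \<alpha> < \<gamma>}. z a \<gamma> * u b \<gamma>)"
    unfolding w_def scaleR_sum_right by (intro sum.cong refl) simp
  show ?thesis
    unfolding e using arg_cong[OF R, of "\<lambda>x. s b *\<^sub>R x"] assms(5)
    by (cases "\<alpha> = \<beta>") (simp_all add: w_def scaleR_add_right mult.commute)
qed

text \<open>For coinciding rows and columns the relation between \<open>u\<close> and \<open>z\<close> is a triangular system
  for the products \<open>u c \<alpha> * z c \<alpha>\<close>, which is solved from the last row upwards. The constant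
  term comes from their sum being \<open>1\<close>.\<close>

lemma w_z_diag:
  assumes "a \<in> I" "\<alpha> \<in> I"
  defines "Q \<equiv> \<lambda>c. q *\<^sub>R (z c \<alpha> * w c \<alpha>) + (q - 1 / q) *\<^sub>R (\<Sum>\<gamma>\<in>{\<gamma>\<in>I. \<alpha> < \<gamma>}. z c \<gamma> * w c \<gamma>)"
  shows "w a \<alpha> * z a \<alpha> = q *\<^sub>R Q a + (q - 1 / q) *\<^sub>R (\<Sum>c\<in>{c\<in>I. a < c}. Q c) + (1 - q\<^sup>2) *\<^sub>R 1"
proof -
  define p where "p c = u c \<alpha> * z c \<alpha>" for c
  define \<sigma> where "\<sigma> c = sum p {b \<in> I. c < b}" for c
  have rel: "s c *\<^sub>R (q *\<^sub>R p c + (q - 1 / q) *\<^sub>R sum p {b \<in> I. b < c}) = Q c" if "c \<in> I" for c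
  proof -
    have e2: "(\<Sum>\<gamma>\<in>{\<gamma>\<in>I. \<alpha> < \<gamma>}. z c \<gamma> * w c \<gamma>) = s c *\<^sub>R (\<Sum>\<gamma>\<in>{\<gamma>\<in>I. \<alpha> < \<gamma>}. z c \<gamma> * u c \<gamma>)"
      unfolding w_def scaleR_sum_right by (intro sum.cong refl) simp
    have "q *\<^sub>R p c + (q - 1 / q) *\<^sub>R sum p {b \<in> I. b < c}
        = q *\<^sub>R (z c \<alpha> * u c \<alpha>) + (q - 1 / q) *\<^sub>R (\<Sum>\<gamma>\<in>{\<gamma>\<in>I. \<alpha> < \<gamma>}. z c \<gamma> * u c \<gamma>)"
      using uz_relation[OF that that assms(2,2), unfolded sum_if_scaleR] by (simp add: p_def)
    then have "s c *\<^sub>R (q *\<^sub>R p c + (q - 1 / q) *\<^sub>R sum p {b \<in> I. b < c})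
        = s c *\<^sub>R (q *\<^sub>R (z c \<alpha> * u c \<alpha>) + (q - 1 / q) *\<^sub>R (\<Sum>\<gamma>\<in>{\<gamma>\<in>I. \<alpha> < \<gamma>}. z c \<gamma> * u c \<gamma>))"
      by simp
    also have "\<dots> = Q c" unfolding Q_def e2 by (simp add: w_def scaleR_add_right mult.commute)
    finally show ?thesis .
  qed
  \<comment> \<open>The total \<open>sum p I = 1\<close> turns sums over earlier rows into sums over
    later ones, which makes elimination from the last row possible.\<close>
  have split: "sum p {b \<in> I. b < c} = 1 - p c - \<sigma> c" if "c \<in> I" for c
  proof -
    have "sum p I = sum p ({b \<in> I. b < c} \<union> ({c} \<union> {b \<in> I. c < b}))"
      using that by (intro arg_cong[of _ _ "sum p"]) auto
    also have "\<dots> = sum p {b \<in> I. b < c} + (p c + \<sigma> c)"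
      unfolding \<sigma>_def by (subst sum.union_disjoint) (auto simp: sum.insert_if)
    finally show ?thesis using uz[OF assms(2,2)] by (simp add: p_def algebra_simps)
  qed
  have sp: "s c *\<^sub>R p c = q *\<^sub>R Q c + (q\<^sup>2 - 1) *\<^sub>R (s c *\<^sub>R (\<sigma> c - 1))" if "c \<in> I" for c
  proof -
    have "Q c = s c *\<^sub>R ((1 / q) *\<^sub>R p c - (q - 1 / q) *\<^sub>R (\<sigma> c - 1))"
      unfolding rel[OF that, symmetric] split[OF that] by (simp add: algebra_simps)
    then have "q *\<^sub>R Q c = s c *\<^sub>R p c - (q\<^sup>2 - 1) *\<^sub>R (s c *\<^sub>R (\<sigma> c - 1))"
      using q by (simp add: scaleR_diff_right mult.commute power2_eq_square right_diff_distrib ac_simps)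
    then show ?thesis by simp
  qed
  \<comment> \<open>Row \<open>n\<close> is the base: \<open>s n = 1\<close> and no later row
    exists. Passing to the preceding row divides \<open>s\<close> by \<open>q\<^sup>2\<close>, which
    cancels the factor \<open>q\<^sup>2\<close> obtained by adding \<open>\<sigma> c - 1\<close> to
    the right side of \<open>sp\<close>.\<close>
  have sig: "s (n - m) *\<^sub>R (\<sigma> (n - m) - 1) = (1 / q) *\<^sub>R sum Q {b \<in> I. n - m < b} - 1" if "m < n" for m
    using that
  proof (induction m)
    case 0
    have "sum f {b \<in> I. n < b} = 0" for f :: "nat \<Rightarrow> 'a" by (intro sum.neutral) (auto simp: mem_I)
    then show ?case by (simp add: \<sigma>_def s_def)
  next
    case (Suc m)
    define c where "c = n - m"
    define d where "d = c - 1"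
    have c: "c \<in> I" "n - Suc m = d" "c = Suc d" using Suc.prems by (auto simp: c_def d_def mem_I)
    have set: "{b \<in> I. d < b} = insert c {b \<in> I. c < b}" using c by (auto simp: mem_I)
    have "s d = (- q) powi (- 2) * s c"
      unfolding s_def using q c by (subst power_int_add[symmetric]) (auto intro!: arg_cong2[of _ _ _ _ "(powi)"] simp: of_nat_diff mem_I)
    then have s: "s d = s c / q\<^sup>2" by (simp add: power_int_minus divide_inverse)
    have "\<sigma> d - 1 = p c + (\<sigma> c - 1)" unfolding \<sigma>_def set by simp
    then have "s d *\<^sub>R (\<sigma> d - 1) = (1 / q\<^sup>2) *\<^sub>R (s c *\<^sub>R p c + s c *\<^sub>R (\<sigma> c - 1))"
      by (simp add: s scaleR_add_right scaleR_diff_right)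
    also have "\<dots> = (1 / q\<^sup>2) *\<^sub>R (q *\<^sub>R Q c + q\<^sup>2 *\<^sub>R (s c *\<^sub>R (\<sigma> c - 1)))"
      unfolding sp[OF c(1)] by (simp add: scaleR_left_diff_distrib left_diff_distrib)
    also have "\<dots> = (1 / q) *\<^sub>R Q c + ((1 / q) *\<^sub>R sum Q {b \<in> I. c < b} - 1)"
      using q Suc by (simp add: scaleR_add_right c_def power2_eq_square)
    finally show ?case unfolding c set by (simp add: scaleR_add_right)
  qed
  have "s a *\<^sub>R (\<sigma> a - 1) = (1 / q) *\<^sub>R sum Q {b \<in> I. a < b} - 1"
    using sig[of "n - a"] assms(1) by (simp add: mem_I)
  then have "w a \<alpha> * z a \<alpha> = q *\<^sub>R Q a + (q\<^sup>2 - 1) *\<^sub>R ((1 / q) *\<^sub>R sum Q {b \<in> I. a < b} - 1)"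
    using sp[OF assms(1)] by (simp add: w_def p_def)
  then show ?thesis using q by (simp add: scaleR_diff_right power2_eq_square divide_simps algebra_simps)
qed

lemma qgl_transpose: "qgl q n I (\<lambda>a \<alpha>. z \<alpha> a) T"
  using I_eq q qmat_transpose[OF z q] T_det det_T by unfold_locales (simp_all add: det_transpose[OF z])

text \<open>The exponent \<open>a + \<alpha> - 2n\<close> is symmetric, although neither
  \<open>u\<close> nor the row scaling is. Results for distinct rows therefore yield results for
  distinct columns.\<close>

lemma w_transpose: "qgl.w q n I (\<lambda>a \<alpha>. z \<alpha> a) T \<alpha> a = w a \<alpha>"
  unfolding w_eq qgl.w_eq[OF qgl_transpose] minor_transpose[OF z finite_I]
  by (auto simp: add.commute)

lemma Rc_sum:
  fixes F :: "nat \<Rightarrow> nat \<Rightarrow> 'b::real_vector"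
  assumes "a \<in> I" "b \<in> I"
  shows "(\<Sum>a'\<in>I. \<Sum>b'\<in>I. Rc q b a b' a' *\<^sub>R F a' b') =
    (if a = b then F a a - (1 / q\<^sup>2 - 1) *\<^sub>R (\<Sum>c\<in>{c\<in>I. a < c}. F c c) else (1 / q) *\<^sub>R F a b)"
proof (cases "a = b")
  case True
  have "(\<Sum>b'\<in>I. Rc q b a b' a' *\<^sub>R F a' b') =
      (if a' = a then F a' a' else 0) + (if a < a' then (- (1 / q\<^sup>2 - 1)) *\<^sub>R F a' a' else 0)"
    if "a' \<in> I" for a'
  proof -
    have "(\<Sum>b'\<in>I. Rc q b a b' a' *\<^sub>R F a' b') = (\<Sum>b'\<in>I. if b' = a' then Rc q b a b' a' *\<^sub>R F a' b' else 0)"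
      using True by (intro sum.cong refl) (auto simp: Rc_def)
    then show ?thesis using True that by (simp add: Rc_def)
  qed
  then show ?thesis using True assms by (simp add: sum.distrib sum.inter_filter[symmetric])
      (simp add: scaleR_sum_right scaleR_left.diff sum_subtractf)
next
  case False
  have "(\<Sum>b'\<in>I. Rc q b a b' a' *\<^sub>R F a' b') = (if a' = a then (1 / q) *\<^sub>R F a' b else 0)" for a'
  proof -
    have "(\<Sum>b'\<in>I. Rc q b a b' a' *\<^sub>R F a' b') = (\<Sum>b'\<in>I. if b' = b then (if a' = a then 1 / q else 0) *\<^sub>R F a' b' else 0)"
      using False by (intro sum.cong refl) (auto simp: Rc_def)
    then show ?thesis using assms by simp
  qed
  then show ?thesis using False assms by simp
qed

text \<open>The coefficient is a product of a row part and a column part, so two applications of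
  \<open>Rc_sum\<close> collapse the fourfold sum. What remains depends only on which of the two
  index pairs coincide.\<close>

lemma cross_relation:
  assumes "a \<in> I" "b \<in> I" "\<alpha> \<in> I" "\<beta> \<in> I"
  shows "w b \<beta> * z a \<alpha> = q\<^sup>2 *\<^sub>R (\<Sum>a'\<in>I. \<Sum>b'\<in>I. \<Sum>\<alpha>'\<in>I. \<Sum>\<beta>'\<in>I.
      (Rc q b a b' a' * Rc q \<beta> \<alpha> \<beta>' \<alpha>') *\<^sub>R (z a' \<alpha>' * w b' \<beta>'))
    + ((1 - q\<^sup>2) * (if a = b \<and> \<alpha> = \<beta> then 1 else 0)) *\<^sub>R 1"
proof -
  have "(\<Sum>a'\<in>I. \<Sum>b'\<in>I. \<Sum>\<alpha>'\<in>I. \<Sum>\<beta>'\<in>I.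
      (Rc q b a b' a' * Rc q \<beta> \<alpha> \<beta>' \<alpha>') *\<^sub>R (z a' \<alpha>' * w b' \<beta>')) =
    (\<Sum>a'\<in>I. \<Sum>b'\<in>I. Rc q b a b' a' *\<^sub>R (\<Sum>\<alpha>'\<in>I. \<Sum>\<beta>'\<in>I. Rc q \<beta> \<alpha> \<beta>' \<alpha>' *\<^sub>R (z a' \<alpha>' * w b' \<beta>')))"
    by (simp add: scaleR_sum_right)
  note eq = this[unfolded Rc_sum[OF assms(3,4)] Rc_sum[OF assms(1,2)]]
  consider "a \<noteq> b" "\<alpha> \<noteq> \<beta>" | "a \<noteq> b" "\<alpha> = \<beta>" | "a = b" "\<alpha> \<noteq> \<beta>" | "a = b" "\<alpha> = \<beta>" by blast
  then show ?thesis
  proof cases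
    case 1
    then show ?thesis unfolding eq using w_z_neq[OF assms] q by (simp add: power2_eq_square)
  next
    case 2
    then show ?thesis unfolding eq using w_z_neq[OF assms] q
      by (simp add: scaleR_diff_right power2_eq_square algebra_simps)
  next
    case 3
    then have "\<alpha> \<noteq> \<beta>" by simp
    \<comment> \<open>Equal rows with distinct columns become distinct rows with equal columns after
      transposition.\<close>
    from qgl.w_z_neq[OF qgl_transpose assms(3,4,1,2) this]
    show ?thesis unfolding eq w_transpose using 3 q
      by (simp add: scaleR_diff_right power2_eq_square algebra_simps)
        (simp add: scaleR_sum_right sum.distrib sum_subtractf algebra_simps)
  next
    case 4
    define Q where "Q c = z c \<alpha> * w c \<alpha> - (1 / q\<^sup>2 - 1) *\<^sub>R (\<Sum>\<gamma>\<in>{\<gamma>\<in>I. \<alpha> < \<gamma>}. z c \<gamma> * w c \<gamma>)" for c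
    have Q: "q *\<^sub>R (z c \<alpha> * w c \<alpha>) + (q - 1 / q) *\<^sub>R (\<Sum>\<gamma>\<in>{\<gamma>\<in>I. \<alpha> < \<gamma>}. z c \<gamma> * w c \<gamma>) = q *\<^sub>R Q c" for c
      unfolding Q_def using q by (simp add: scaleR_diff_right power2_eq_square algebra_simps)
    have "w a \<alpha> * z a \<alpha> = q\<^sup>2 *\<^sub>R (Q a - (1 / q\<^sup>2 - 1) *\<^sub>R (\<Sum>c\<in>{c\<in>I. a < c}. Q c)) + (1 - q\<^sup>2) *\<^sub>R 1"
      using w_z_diag[OF assms(1,3)] q unfolding Q
      by (simp add: scaleR_sum_right[symmetric] scaleR_diff_right power2_eq_square algebra_simps)
    then show ?thesis unfolding eq using 4 by (simp add: Q_def)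
  qed
qed

end

section \<open>Presented algebras\<close>

text \<open>Complex scalars get an interpretation of their own: the target class has only real
  scaling, and evaluation in the opposite algebra must conjugate them.\<close>

primrec ev :: "(complex \<Rightarrow> 'a::ring_1) \<Rightarrow> ('g \<Rightarrow> 'a) \<Rightarrow> 'g expr \<Rightarrow> 'a" where
  "ev \<sigma> g (EGen x) = g x"
| "ev \<sigma> g (EScal c) = \<sigma> c"
| "ev \<sigma> g (EAdd x y) = ev \<sigma> g x + ev \<sigma> g y"
| "ev \<sigma> g (EMul x y) = ev \<sigma> g x * ev \<sigma> g y"

lemma pcong_ev_id:
  fixes g :: "'g \<Rightarrow> complex"
  assumes "pcong R x y" and "\<And>l r. (l, r) \<in> R \<Longrightarrow> ev (\<lambda>c. c) g l = ev (\<lambda>c. c) g r"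
  shows "ev (\<lambda>c. c) g x = ev (\<lambda>c. c) g y"
  using assms(1) by (induction rule: pcong.induct) (auto simp: assms(2) algebra_simps)

text \<open>The factor without relations does not collapse; this secures \<open>0 \<noteq> 1\<close>
  in the product type, whatever happens in the other factors.\<close>

lemma not_pcong_empty_0_1: "\<not> pcong {} (EScal 0 :: 'g expr) (EScal 1)"
  using pcong_ev_id[of "{}" "EScal 0 :: 'g expr" "EScal 1" "\<lambda>_. 0"] by auto

text \<open>The product of the presented algebras over all sets of relations. A type cannot depend on
  \<open>q\<close> and \<open>n\<close>, but this product contains every presented algebra as a factor.\<close>

quotient_type 'g palg = "('g expr \<times> 'g expr) set \<Rightarrow> 'g expr" / "\<lambda>F G. \<forall>R. pcong R (F R) (G R)"
  by (intro equivpI) (auto simp: reflp_def symp_def transp_def intro: prefl psym ptrans)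

instantiation palg :: (type) real_algebra_1
begin

lift_definition zero_palg :: "'a palg" is "\<lambda>R. EScal 0" .
lift_definition one_palg :: "'a palg" is "\<lambda>R. EScal 1" .
lift_definition plus_palg :: "'a palg \<Rightarrow> 'a palg \<Rightarrow> 'a palg" is "\<lambda>F G R. EAdd (F R) (G R)"
  by (simp add: padd_cong)
lift_definition times_palg :: "'a palg \<Rightarrow> 'a palg \<Rightarrow> 'a palg" is "\<lambda>F G R. EMul (F R) (G R)"
  by (simp add: pmul_cong)
lift_definition uminus_palg :: "'a palg \<Rightarrow> 'a palg" is "\<lambda>F R. EMul (EScal (- 1)) (F R)"
  by (simp add: pmul_cong prefl)
lift_definition minus_palg :: "'a palg \<Rightarrow> 'a palg \<Rightarrow> 'a palg"
  is "\<lambda>F G R. EAdd (F R) (EMul (EScal (- 1)) (G R))"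
  by (simp add: padd_cong pmul_cong prefl)
lift_definition scaleR_palg :: "real \<Rightarrow> 'a palg \<Rightarrow> 'a palg" is "\<lambda>r F R. EMul (EScal (of_real r)) (F R)"
  by (simp add: pmul_cong prefl)

instance
proof
  fix a b c :: "'a palg" and r t :: real
  show "a + b + c = a + (b + c)" by transfer (simp add: padd_assoc)
  show "a + b = b + a" by transfer (simp add: padd_comm)
  show "0 + a = a" by transfer (meson padd_comm padd_zero ptrans)
  show "- a + a = 0" by transfer (meson padd_comm padd_neg ptrans)
  show "a - b = a + - b" by transfer (simp add: prefl)
  show "a * b * c = a * (b * c)" by transfer (simp add: pmul_assoc)
  show "(a + b) * c = a * c + b * c" by transfer (simp add: pdistr)
  show "a * (b + c) = a * b + a * c" by transfer (simp add: pdistl)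
  show "1 * a = a" by transfer (simp add: pmul_one_l)
  show "a * 1 = a" by transfer (simp add: pmul_one_r)
  show "(0::'a palg) \<noteq> 1" by transfer (use not_pcong_empty_0_1 in blast)
  show "r *\<^sub>R (a + b) = r *\<^sub>R a + r *\<^sub>R b" by transfer (simp add: pdistl)
  show "(r + t) *\<^sub>R a = r *\<^sub>R a + t *\<^sub>R a"
    by transfer (simp, meson pdistr pmul_cong prefl pscal_add ptrans)
  show "r *\<^sub>R t *\<^sub>R a = (r * t) *\<^sub>R a"
    by transfer (simp, meson pmul_assoc pmul_cong prefl pscal_mul psym ptrans)
  show "1 *\<^sub>R a = a" by transfer (simp add: pmul_one_l)
  show "r *\<^sub>R a * b = r *\<^sub>R (a * b)" by transfer (simp add: pmul_assoc)
  show "a * r *\<^sub>R b = r *\<^sub>R (a * b)"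
    by transfer (meson pmul_assoc pmul_cong prefl pscal_central psym ptrans)
qed

end

lift_definition scal :: "complex \<Rightarrow> 'g palg" is "\<lambda>c R. EScal c" .

lemma scal_of_real: "scal (of_real r) = r *\<^sub>R 1"
  by transfer (simp add: pmul_one_r psym)

lemma scal_0: "scal 0 = 0" and scal_1: "scal 1 = 1"
  by (transfer, simp add: prefl)+

text \<open>Lifts an expression to the product so that the relations \<open>R0\<close> hold in every factor: outside the
  factor \<open>R0\<close> it is evaluated at a character \<open>\<chi>\<close> of the algebra presented by \<open>R0\<close>.\<close>

lift_definition emb :: "('g expr \<times> 'g expr) set \<Rightarrow> ('g \<Rightarrow> complex) \<Rightarrow> 'g expr \<Rightarrow> 'g palg"
  is "\<lambda>R0 \<chi> e R. if R = R0 then e else EScal (ev (\<lambda>c. c) \<chi> e)" .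

lemma emb_eq_imp_pcong: "emb R \<chi> x = emb R \<chi> y \<Longrightarrow> pcong R x y"
  by transfer (metis (full_types))

lemma pcong_imp_emb_eq:
  assumes "\<And>l r. (l, r) \<in> R \<Longrightarrow> ev (\<lambda>c. c) \<chi> l = ev (\<lambda>c. c) \<chi> r" "pcong R x y"
  shows "emb R \<chi> x = emb R \<chi> y"
  using pcong_ev_id[OF assms(2,1)] assms(2) by transfer (simp add: prefl)

lemma emb_simps:
  "emb R \<chi> (EScal c) = scal c"
  "emb R \<chi> (EAdd x y) = emb R \<chi> x + emb R \<chi> y"
  "emb R \<chi> (EMul x y) = emb R \<chi> x * emb R \<chi> y"
  by (transfer, simp add: prefl pscal_add pscal_mul)+

lemma emb_ev: "emb R \<chi> e = ev scal (\<lambda>g. emb R \<chi> (EGen g)) e"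
  by (induction e) (simp_all add: emb_simps)

section \<open>Homomorphisms and conjugate-linear antihomomorphisms on expressions\<close>

primrec esubst :: "('g \<Rightarrow> 'h expr) \<Rightarrow> 'g expr \<Rightarrow> 'h expr" where
  "esubst s (EGen x) = s x"
| "esubst s (EScal c) = EScal c"
| "esubst s (EAdd x y) = EAdd (esubst s x) (esubst s y)"
| "esubst s (EMul x y) = EMul (esubst s x) (esubst s y)"

primrec astar :: "('g \<Rightarrow> 'h expr) \<Rightarrow> 'g expr \<Rightarrow> 'h expr" where
  "astar s (EGen x) = s x"
| "astar s (EScal c) = EScal (cnj c)"
| "astar s (EAdd x y) = EAdd (astar s x) (astar s y)"
| "astar s (EMul x y) = EMul (astar s y) (astar s x)"

lemma pcong_esubst:
  assumes "pcong R x y" and "\<And>l r. (l, r) \<in> R \<Longrightarrow> pcong R' (esubst s l) (esubst s r)"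
  shows "pcong R' (esubst s x) (esubst s y)"
  using assms(1) by (induction rule: pcong.induct) (auto simp: assms(2) intro: pcong.intros)

lemma pcong_astar:
  assumes "pcong R x y" and "\<And>l r. (l, r) \<in> R \<Longrightarrow> pcong R' (astar s l) (astar s r)"
  shows "pcong R' (astar s x) (astar s y)"
  using assms(1)
proof (induction rule: pcong.induct)
  case (padd_neg x)
  then show ?case by simp (meson padd_cong pcong.padd_neg prefl pscal_central psym ptrans)
next
  case (pscal_mul a b)
  then show ?case by simp (metis pcong.pscal_mul mult.commute)
qed (auto simp: assms(2) intro: pcong.intros)

text \<open>A star operation is evaluation in the opposite algebra with conjugated scalars; hence
  the formulas for determinants and minors apply to starred expressions.\<close>

lemma emb_astar:
  "emb R \<chi> (astar s e) = unop (ev (\<lambda>c. Op (scal (cnj c))) (\<lambda>g. Op (emb R \<chi> (s g))) e)"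
  by (induction e) (simp_all add: emb_simps)

section \<open>From sums over permutations to row expansions\<close>

lemma ev_esum: "\<sigma> 0 = 0 \<Longrightarrow> ev \<sigma> g (esum xs) = sum_list (map (ev \<sigma> g) xs)"
  unfolding esum_def by (induction xs) simp_all

lemma mset_perms: "bs \<in> set (perms xs) \<Longrightarrow> mset bs = mset xs"
proof (induction xs arbitrary: bs rule: perms.induct)
  case (2 y ys)
  then obtain x cs where x: "x \<in> set (y # ys)" "cs \<in> set (perms (remove1 x (y # ys)))" "bs = x # cs"
    by auto
  then have "mset cs = mset (remove1 x (y # ys))" using 2 by blast
  then show ?case using x by (simp only: mset.simps mset_remove1) simp
qed simp

text \<open>Inversions either involve the first position, where they count the smaller entries, or
  lie in the tail. This matches the weight in the recursion of \<open>qd\<close>.\<close>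

lemma inversions_Cons:
  assumes "distinct xs"
  shows "inversions (x # xs) = nbelow (set xs) x + inversions xs"
proof -
  let ?A = "{j. j < length xs \<and> xs ! j < x}"
  let ?B = "{(i, j). i < j \<and> j < length xs \<and> xs ! i > xs ! j}"
  have eq: "{(i, j). i < j \<and> j < length (x # xs) \<and> (x # xs) ! i > (x # xs) ! j}
      = (\<lambda>j. (0, Suc j)) ` ?A \<union> (\<lambda>(i, j). (Suc i, Suc j)) ` ?B" (is "?L = ?R")
  proof (intro Set.set_eqI iffI)
    fix p assume p: "p \<in> ?L"
    then obtain i j where ij: "p = (i, Suc j)" "i < Suc j" by (cases p; cases "snd p") auto
    then show "p \<in> ?R" using p by (cases i) (auto simp: image_iff)
  qed auto
  have "finite ?B" by (rule finite_subset[of _ "{..<length xs} \<times> {..<length xs}"]) auto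
  moreover have "inj_on (\<lambda>j. (0::nat, Suc j)) ?A" "inj_on (\<lambda>(i, j). (Suc i, Suc j)) ?B"
    by (auto simp: inj_on_def)
  ultimately have "inversions (x # xs) = card ?A + card ?B"
    unfolding inversions_def eq by (subst card_Un_disjoint) (auto simp: card_image)
  moreover have "card ?A = nbelow (set xs) x"
  proof -
    have "{y \<in> set xs. y < x} = (!) xs ` ?A" by (auto simp: set_conv_nth)
    moreover have "inj_on ((!) xs) ?A" using assms by (auto simp: inj_on_def nth_eq_iff_index_eq)
    ultimately show ?thesis unfolding nbelow_def by (simp add: card_image)
  qed
  ultimately show ?thesis unfolding inversions_def by simp
qed

lemma sum_list_concat: "sum_list (concat xss) = sum_list (map sum_list xss)"
  by (induction xss) simp_all

lemma sum_list_scaleR_mult: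
  fixes x :: "'a::real_algebra_1"
  shows "(\<Sum>y\<leftarrow>ys. c *\<^sub>R (x * f y)) = c *\<^sub>R (x * (\<Sum>y\<leftarrow>ys. f y))"
  by (induction ys) (simp_all add: algebra_simps)

lemma sum_perms_eq_qd:
  fixes z :: "nat \<Rightarrow> nat \<Rightarrow> 'a::real_algebra_1"
  shows "distinct als \<Longrightarrow> length as = length als \<Longrightarrow>
    (\<Sum>bs\<leftarrow>perms als. (- q) ^ inversions bs *\<^sub>R prod_list (map2 z as bs)) = qd q z as (set als)"
proof (induction as arbitrary: als)
  case Nil
  then show ?case by (simp add: inversions_def)
next
  case (Cons a as)
  have "als \<noteq> []" using Cons.prems by auto
  then have "perms als = concat (map (\<lambda>x. map ((#) x) (perms (remove1 x als))) als)"
    by (cases als) simp_all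
  then have "(\<Sum>bs\<leftarrow>perms als. (- q) ^ inversions bs *\<^sub>R prod_list (map2 z (a # as) bs))
    = (\<Sum>x\<leftarrow>als. \<Sum>bs\<leftarrow>perms (remove1 x als). (- q) ^ inversions (x # bs) *\<^sub>R (z a x * prod_list (map2 z as bs)))"
    by (simp add: map_concat sum_list_concat comp_def)
  also have "\<dots> = (\<Sum>x\<leftarrow>als. (- q) ^ nbelow (set als) x *\<^sub>R (z a x * qd q z as (set als - {x})))"
  proof (intro arg_cong[of _ _ sum_list] map_cong refl)
    fix x assume x: "x \<in> set als"
    have "(\<Sum>bs\<leftarrow>perms (remove1 x als). (- q) ^ inversions (x # bs) *\<^sub>R (z a x * prod_list (map2 z as bs)))
      = (\<Sum>bs\<leftarrow>perms (remove1 x als). (- q) ^ nbelow (set als) x *\<^sub>R (z a x * ((- q) ^ inversions bs *\<^sub>R prod_list (map2 z as bs))))"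
    proof (intro arg_cong[of _ _ sum_list] map_cong refl)
      fix bs assume "bs \<in> set (perms (remove1 x als))"
      then have m: "mset bs = mset (remove1 x als)" by (rule mset_perms)
      then have "distinct bs" "set bs = set als - {x}"
        using Cons.prems(1) by (metis distinct_remove1 mset_eq_imp_distinct_iff, metis mset_eq_setD set_remove1_eq)
      then have "inversions (x # bs) = nbelow (set als) x + inversions bs"
        using inversions_Cons[of bs x] nbelow_remove[of "set als" x x] x by simp
      then show "(- q) ^ inversions (x # bs) *\<^sub>R (z a x * prod_list (map2 z as bs)) =
          (- q) ^ nbelow (set als) x *\<^sub>R (z a x * ((- q) ^ inversions bs *\<^sub>R prod_list (map2 z as bs)))"
        by (simp add: power_add)
    qed
    also have "\<dots> = (- q) ^ nbelow (set als) x *\<^sub>R (z a x *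
        (\<Sum>bs\<leftarrow>perms (remove1 x als). (- q) ^ inversions bs *\<^sub>R prod_list (map2 z as bs)))"
      by (rule sum_list_scaleR_mult)
    also have "(\<Sum>bs\<leftarrow>perms (remove1 x als). (- q) ^ inversions bs *\<^sub>R prod_list (map2 z as bs))
      = qd q z as (set als - {x})"
      using Cons x by (subst Cons.IH) (auto simp: length_remove1)
    finally show "(\<Sum>bs\<leftarrow>perms (remove1 x als). (- q) ^ inversions (x # bs) *\<^sub>R (z a x * prod_list (map2 z as bs)))
      = (- q) ^ nbelow (set als) x *\<^sub>R (z a x * qd q z as (set als - {x}))" .
  qed
  also have "\<dots> = qd q z (a # as) (set als)"
    using Cons.prems(1) by (simp add: sum.distinct_set_conv_list)
  finally show ?case .
qed

lemma ev_eprod: "\<sigma> 1 = 1 \<Longrightarrow> ev \<sigma> g (eprod xs) = prod_list (map (ev \<sigma> g) xs)"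
  unfolding eprod_def by (induction xs) simp_all

lemma ev_qminor:
  fixes \<sigma> :: "complex \<Rightarrow> 'a::real_algebra_1"
  assumes \<sigma>: "\<And>r. \<sigma> (of_real r) = r *\<^sub>R 1" and "distinct als" "length as = length als"
  shows "ev \<sigma> g (qminor zg q as als) = qd q (\<lambda>a b. g (zg a b)) as (set als)"
proof -
  have "\<sigma> 0 = 0" "\<sigma> 1 = 1" using \<sigma>[of 0] \<sigma>[of 1] by simp_all
  then have "ev \<sigma> g (qminor zg q as als)
      = (\<Sum>bs\<leftarrow>perms als. (- q) ^ inversions bs *\<^sub>R prod_list (map2 (\<lambda>a b. g (zg a b)) as bs))"
    unfolding qminor_def by (simp add: ev_esum ev_eprod \<sigma> comp_def case_prod_unfold del: of_real_power of_real_minus)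
  then show ?thesis using sum_perms_eq_qd[OF assms(2,3), of q "\<lambda>a b. g (zg a b)"] by simp
qed

lemma idx_eq: "idx n = sl {1..n}"
  unfolding idx_def by (metis Suc_eq_plus1 atLeastLessThanSuc_atLeastAtMost sorted_list_of_set_range)

lemma filter_idx: "filter (\<lambda>i. i \<noteq> a) (idx n) = sl ({1..n} - {a})"
  unfolding idx_eq
  by (auto simp: sorted_list_of_set_remove distinct_remove1_removeAll removeAll_filter_not_eq intro!: filter_cong)

section \<open>The involution and the homomorphism\<close>

definition wexpr :: "real \<Rightarrow> nat \<Rightarrow> nat \<Rightarrow> nat \<Rightarrow> genB expr" where
  "wexpr q n a al = (if a \<in> {1..n} \<and> al \<in> {1..n} then
      EMul (EScal (complex_of_real (- q) powi (int a + int al - 2 * int n)))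
                 (EMul (EGen Tg) (qdet_compl ZBg q n a al)) else EScal 0)"

text \<open>The value at \<open>Tg\<close> is forced: the adjoint of \<open>T\<close> must invert
  the adjoint of the determinant, which by \<open>det_w\<close> is \<open>prod s I\<close> times
  \<open>T\<close>.\<close>

definition star_gen :: "real \<Rightarrow> nat \<Rightarrow> genB \<Rightarrow> genB expr" where
  "star_gen q n g = (case g of ZBg a al \<Rightarrow> wexpr q n a al
     | Tg \<Rightarrow> EMul (EScal (of_real (1 / prod (qgl.s q n) {1..n}))) (qdet ZBg q n))"

lemma star_gen_ZBg: "star_gen q n (ZBg a al) = wexpr q n a al"
  by (simp add: star_gen_def)

lemma star_gen_Tg:
  "star_gen q n Tg = EMul (EScal (of_real (1 / prod (qgl.s q n) {1..n}))) (qdet ZBg q n)"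
  by (simp add: star_gen_def)

definition psi_gen :: "real \<Rightarrow> nat \<Rightarrow> genA \<Rightarrow> genB expr" where
  "psi_gen q n g = (case g of Zg a al \<Rightarrow> EGen (ZBg a al) | Zsg a al \<Rightarrow> wexpr q n a al)"

text \<open>The character of the localized algebra at the identity matrix, with \<open>T\<close>
  sent to 1. The correction term of (R) vanishes there, since its two factors cannot both be
  diagonal. It fills the other factors of the product in \<open>emb_GL\<close>.\<close>

definition id_char :: "nat \<Rightarrow> genB \<Rightarrow> complex" where
  "id_char n g = (case g of ZBg a al \<Rightarrow> if a = al \<and> a \<in> {1..n} then 1 else 0 | Tg \<Rightarrow> 1)"

lemma qd_identity:
  "finite A \<Longrightarrow> A \<subseteq> I \<Longrightarrow> qd q (\<lambda>a al. if a = al \<and> a \<in> I then 1 else 0) (sl A) A = 1"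
proof (induction "card A" arbitrary: A)
  case (Suc k)
  let ?m = "Min A"
  have ne: "A \<noteq> {}" using Suc.hyps(2) by auto
  then have m: "?m \<in> A" using Suc.prems by simp
  then have mI: "?m \<in> I" using Suc.prems by auto
  have "qd q (\<lambda>a al. if a = al \<and> a \<in> I then 1 else 0) (sl A) A =
    (\<Sum>x\<in>A. if x = ?m then (- q) ^ nbelow A ?m *\<^sub>R qd q (\<lambda>a al. if a = al \<and> a \<in> I then 1 else 0) (sl (A - {?m})) (A - {?m}) else 0)"
    unfolding sorted_list_of_set_nonempty[OF Suc.prems(1) ne] qd.simps by (intro sum.cong refl) (auto simp: mI)
  also have "\<dots> = (- q) ^ nbelow A ?m *\<^sub>R qd q (\<lambda>a al. if a = al \<and> a \<in> I then 1 else 0) (sl (A - {?m})) (A - {?m})"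
    using Suc.prems(1) m by simp
  also have "nbelow A ?m = 0"
    using Suc.prems(1) by (fastforce simp: nbelow_def dest: Min_le)
  also have "qd q (\<lambda>a al. if a = al \<and> a \<in> I then 1 else 0) (sl (A - {?m})) (A - {?m}) = (1::'a)"
    using Suc m by (intro Suc.hyps(1)) auto
  finally show ?case by simp
qed simp

lemma ev_qdet:
  fixes \<sigma> :: "complex \<Rightarrow> 'a::real_algebra_1"
  assumes "\<And>r. \<sigma> (of_real r) = r *\<^sub>R 1"
  shows "ev \<sigma> g (qdet zg q n) = det q (\<lambda>a b. g (zg a b)) {1..n}"
  unfolding qdet_def idx_eq by (subst ev_qminor[OF assms]) simp_all

lemma ev_qdet_compl:
  fixes \<sigma> :: "complex \<Rightarrow> 'a::real_algebra_1"
  assumes "\<And>r. \<sigma> (of_real r) = r *\<^sub>R 1" and "a \<in> {1..n}" "al \<in> {1..n}"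
  shows "ev \<sigma> g (qdet_compl zg q n a al) = minor q (\<lambda>a b. g (zg a b)) {1..n} a al"
  unfolding qdet_compl_def filter_idx minor_def using assms(2,3)
  by (subst ev_qminor[OF assms(1)]) simp_all

lemma id_char_relGL:
  assumes "(l, r) \<in> relGL q n"
  shows "ev (\<lambda>c. c) (id_char n) l = ev (\<lambda>c. c) (id_char n) r"
proof -
  have "ev (\<lambda>c. c) (id_char n) (qdet ZBg q n) = 1"
    using qd_identity[of "{1..n}" "{1..n}" q] 
    by (subst ev_qdet) (auto simp: scaleR_conv_of_real id_char_def)
  then show ?thesis using assms unfolding relGL_def relR_def by (auto simp: id_char_def)
qed

abbreviation emb_GL :: "real \<Rightarrow> nat \<Rightarrow> genB expr \<Rightarrow> genB palg" where
  "emb_GL q n \<equiv> emb (relGL q n) (id_char n)"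

abbreviation zGL :: "real \<Rightarrow> nat \<Rightarrow> nat \<Rightarrow> nat \<Rightarrow> genB palg" where
  "zGL q n a al \<equiv> emb_GL q n (EGen (ZBg a al))"

lemma emb_GL_eq_iff: "emb_GL q n x = emb_GL q n y \<longleftrightarrow> pcong (relGL q n) x y"
proof
  assume "pcong (relGL q n) x y"
  then show "emb_GL q n x = emb_GL q n y" by (intro pcong_imp_emb_eq id_char_relGL)
qed (rule emb_eq_imp_pcong)

lemma emb_GL_rel: "(l, r) \<in> relGL q n \<Longrightarrow> emb_GL q n l = emb_GL q n r"
  unfolding emb_GL_eq_iff by (rule prel)

lemma zGL_outside: "a \<notin> {1..n} \<or> al \<notin> {1..n} \<Longrightarrow> zGL q n a al = 0"
  using emb_GL_rel[of "EGen (ZBg a al)" "EScal 0" q n]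
  by (auto simp: relGL_def relR_def emb_simps scal_0)

lemma scal_mult: "scal (of_real r) * x = r *\<^sub>R x"
  by (simp add: scal_of_real)

lemma qmat_zGL:
  assumes "q \<noteq> 0"
  shows "qmat q (zGL q n)"
proof (rule qmatI[OF assms], goal_cases)
  case (1 a \<alpha> \<beta>)
  show ?case
  proof (cases "a \<in> {1..n} \<and> \<alpha> \<in> {1..n} \<and> \<beta> \<in> {1..n}")
    case True
    have "(EMul (EGen (ZBg a \<alpha>)) (EGen (ZBg a \<beta>)),
        EMul (EScal (of_real q)) (EMul (EGen (ZBg a \<beta>)) (EGen (ZBg a \<alpha>)))) \<in> relGL q n"
      unfolding relGL_def relR_def using True 1 by auto
    from emb_GL_rel[OF this] show ?thesis by (simp add: emb_simps scal_mult)
  qed (use zGL_outside in auto)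
next
  case (2 a b \<alpha>)
  show ?case
  proof (cases "a \<in> {1..n} \<and> b \<in> {1..n} \<and> \<alpha> \<in> {1..n}")
    case True
    have "(EMul (EGen (ZBg a \<alpha>)) (EGen (ZBg b \<alpha>)),
        EMul (EScal (of_real q)) (EMul (EGen (ZBg b \<alpha>)) (EGen (ZBg a \<alpha>)))) \<in> relGL q n"
      unfolding relGL_def relR_def using True 2 by auto
    from emb_GL_rel[OF this] show ?thesis by (simp add: emb_simps scal_mult)
  qed (use zGL_outside in auto)
next
  case (3 a b \<alpha> \<beta>)
  show ?case
  proof (cases "a \<in> {1..n} \<and> b \<in> {1..n} \<and> \<alpha> \<in> {1..n} \<and> \<beta> \<in> {1..n}")
    case True
    have "(EMul (EGen (ZBg b \<beta>)) (EGen (ZBg a \<alpha>)), EMul (EGen (ZBg a \<alpha>)) (EGen (ZBg b \<beta>))) \<in> relGL q n"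
      unfolding relGL_def relR_def using True 3 by auto
    from emb_GL_rel[OF this] show ?thesis by (simp add: emb_simps)
  qed (use zGL_outside in auto)
next
  case (4 a b \<alpha> \<beta>)
  show ?case
  proof (cases "a \<in> {1..n} \<and> b \<in> {1..n} \<and> \<alpha> \<in> {1..n} \<and> \<beta> \<in> {1..n}")
    case True
    have "(EMul (EGen (ZBg a \<alpha>)) (EGen (ZBg b \<beta>)), EAdd (EMul (EGen (ZBg b \<beta>)) (EGen (ZBg a \<alpha>)))
            (EMul (EScal (of_real (q - 1 / q))) (EMul (EGen (ZBg a \<beta>)) (EGen (ZBg b \<alpha>))))) \<in> relGL q n"
      unfolding relGL_def relR_def using True 4 by auto
    from emb_GL_rel[OF this] show ?thesis by (simp add: emb_simps scal_mult del: of_real_diff of_real_divide)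
  qed (use zGL_outside in auto)
qed

lemma emb_GL_qdet: "emb_GL q n (qdet ZBg q n) = det q (zGL q n) {1..n}"
  by (subst emb_ev) (simp add: ev_qdet scal_of_real)

lemma emb_GL_qdet_compl:
  "a \<in> {1..n} \<Longrightarrow> al \<in> {1..n} \<Longrightarrow> emb_GL q n (qdet_compl ZBg q n a al) = minor q (zGL q n) {1..n} a al"
  by (subst emb_ev) (simp add: ev_qdet_compl scal_of_real)

lemma qgl_GL:
  assumes "q \<noteq> 0"
  shows "qgl q n {1..n} (zGL q n) (emb_GL q n (EGen Tg))"
proof
  show "qmat q (zGL q n)" by (rule qmat_zGL[OF assms])
  have "(EMul (EGen Tg) (qdet ZBg q n), EScal 1) \<in> relGL q n"
    "(EMul (qdet ZBg q n) (EGen Tg), EScal 1) \<in> relGL q n" by (auto simp: relGL_def)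
  from this[THEN emb_GL_rel]
  show "emb_GL q n (EGen Tg) * det q (zGL q n) {1..n} = 1"
    "det q (zGL q n) {1..n} * emb_GL q n (EGen Tg) = 1"
    by (simp_all add: emb_simps scal_1 emb_GL_qdet)
qed (use assms in auto)

abbreviation wGL :: "real \<Rightarrow> nat \<Rightarrow> nat \<Rightarrow> nat \<Rightarrow> genB palg" where
  "wGL q n \<equiv> qgl.w q n {1..n} (zGL q n) (emb_GL q n (EGen Tg))"

lemma emb_GL_wexpr:
  assumes "q \<noteq> 0"
  shows "emb_GL q n (wexpr q n a al) = wGL q n a al"
proof -
  have "complex_of_real (- q) powi k = of_real ((- q) powi k)" for k by (rule of_real_power_int[symmetric])
  then show ?thesis
    unfolding qgl.w_eq[OF qgl_GL[OF assms]] wexpr_def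
    by (cases "a \<in> {1..n} \<and> al \<in> {1..n}")
      (simp_all only: emb_simps scal_mult emb_GL_qdet_compl scal_0 if_True if_False simp_thms)
qed

abbreviation star_GL :: "real \<Rightarrow> nat \<Rightarrow> genB expr \<Rightarrow> genB expr" where
  "star_GL q n \<equiv> astar (star_gen q n)"

abbreviation psi :: "real \<Rightarrow> nat \<Rightarrow> genA expr \<Rightarrow> genB expr" where
  "psi q n \<equiv> esubst (psi_gen q n)"

lemma Op_scal_cnj: "Op (scal (cnj (of_real r))) = r *\<^sub>R 1"
  by (simp add: op_eq_iff scal_of_real)

lemma emb_GL_star_qdet:
  assumes "q \<noteq> 0"
  shows "emb_GL q n (star_GL q n (qdet ZBg q n)) =
    prod (qgl.s q n) {1..n} *\<^sub>R emb_GL q n (EGen Tg)"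
  unfolding emb_astar ev_qdet[of "\<lambda>c. Op (scal (cnj c))", OF Op_scal_cnj]
    qgl.det_w[OF qgl_GL[OF assms], symmetric]
  by (simp add: star_gen_ZBg emb_GL_wexpr[OF assms])

lemma emb_GL_star_T:
  "emb_GL q n (star_gen q n Tg) = (1 / prod (qgl.s q n) {1..n}) *\<^sub>R det q (zGL q n) {1..n}"
  by (simp add: star_gen_def emb_simps scal_mult emb_GL_qdet del: of_real_divide)

lemma prod_s_nonzero: "q \<noteq> 0 \<Longrightarrow> prod (qgl.s q n) {1..n} \<noteq> 0"
  using qgl.s_nonzero[OF qgl_GL] by auto

lemma star_GL_wexpr:
  assumes "q \<noteq> 0"
  shows "pcong (relGL q n) (star_GL q n (wexpr q n a al)) (EGen (ZBg a al))"
proof (cases "a \<in> {1..n} \<and> al \<in> {1..n}")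
  case True
  have "emb_GL q n (star_GL q n (qdet_compl ZBg q n a al)) =
      unop (minor q (\<lambda>a b. Op (wGL q n a b)) {1..n} a al)"
    unfolding emb_astar using True
    by (simp add: ev_qdet_compl[of "\<lambda>c. Op (scal (cnj c))", OF Op_scal_cnj] star_gen_ZBg emb_GL_wexpr[OF assms])
  moreover have "cnj (complex_of_real (- q) powi k) = of_real ((- q) powi k)" for k
    by (simp only: of_real_power_int[symmetric] complex_cnj_complex_of_real)
  ultimately have "emb_GL q n (star_GL q n (wexpr q n a al)) = (- q) powi (int a + int al - 2 * int n) *\<^sub>R
    (unop (minor q (\<lambda>a b. Op (wGL q n a b)) {1..n} a al) * ((1 / prod (qgl.s q n) {1..n}) *\<^sub>R det q (zGL q n) {1..n}))"
    unfolding wexpr_def using True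
    by (simp only: if_True astar.simps emb_simps emb_GL_star_T scal_of_real mult_scaleR_right mult_1_right simp_thms)
  also have "\<dots> = zGL q n a al"
    using qgl.minor_w[OF qgl_GL[OF assms]] True by blast
  finally show ?thesis unfolding emb_GL_eq_iff .
next
  case False
  then have "(EGen (ZBg a al), EScal 0) \<in> relGL q n" by (auto simp: relGL_def relR_def)
  then show ?thesis unfolding wexpr_def using False by (auto intro: psym prel)
qed

text \<open>The relations (R) go to the relations of \<open>w\<close> in the opposite algebra. In
  the localization relations the scalar from the determinant of \<open>w\<close> cancels the one in
  the value at \<open>Tg\<close>.\<close>

lemma star_GL_rel:
  assumes q: "q \<noteq> 0" and "(l, r) \<in> relGL q n"
  shows "pcong (relGL q n) (star_GL q n l) (star_GL q n r)"
proof -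
  let ?w = "wGL q n"
  note w = qgl.qmat_op_w[OF qgl_GL[OF q], of n]
  have sg: "emb_GL q n (star_gen q n (ZBg a al)) = ?w a al" for a al
    by (simp add: star_gen_ZBg emb_GL_wexpr[OF q])
  have row: "?w a \<beta> * ?w a \<alpha> = q *\<^sub>R (?w a \<alpha> * ?w a \<beta>)" if "\<alpha> < \<beta>" for a \<alpha> \<beta>
    using qmat_same_row[OF w that, of a] by (simp add: op_eq_iff)
  have col: "?w b \<alpha> * ?w a \<alpha> = q *\<^sub>R (?w a \<alpha> * ?w b \<alpha>)" if "a < b" for a b \<alpha>
    using qmat_same_col[OF w that, of \<alpha>] by (simp add: op_eq_iff)
  have com: "?w b \<beta> * ?w a \<alpha> = ?w a \<alpha> * ?w b \<beta>" if "b < a" "\<alpha> < \<beta>" for a b \<alpha> \<beta>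
    using qmat_commute[OF w that] by (simp add: op_eq_iff)
  have cross: "?w b \<beta> * ?w a \<alpha> = ?w a \<alpha> * ?w b \<beta> + (q - 1 / q) *\<^sub>R (?w b \<alpha> * ?w a \<beta>)"
    if "a < b" "\<alpha> < \<beta>" for a b \<alpha> \<beta>
    using qmat_cross[OF w that] by (simp add: op_eq_iff)
  have out: "?w a \<alpha> = 0" if "a \<notin> {1..n} \<or> \<alpha> \<notin> {1..n}" for a \<alpha>
    using qgl.w_eq[OF qgl_GL[OF q], of n a \<alpha>] that by auto
  have sc: "scal (cnj (of_real x)) = x *\<^sub>R 1" for x by (simp add: scal_of_real)
  have T: "det q (zGL q n) {1..n} * emb_GL q n (EGen Tg) = 1" "emb_GL q n (EGen Tg) * det q (zGL q n) {1..n} = 1"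
    using qgl.det_T[OF qgl_GL[OF q]] qgl.T_det[OF qgl_GL[OF q]] by blast+
  consider (R) "(l, r) \<in> relR ZBg q n" | (T1) "l = EMul (EGen Tg) (qdet ZBg q n)" "r = EScal 1"
    | (T2) "l = EMul (qdet ZBg q n) (EGen Tg)" "r = EScal 1"
    using assms(2) unfolding relGL_def by auto
  then have "emb_GL q n (star_GL q n l) = emb_GL q n (star_GL q n r)"
  proof cases
    case R
    then show ?thesis unfolding relR_def
      by (elim UnE CollectE exE conjE disjE Pair_inject)
        (simp_all only: astar.simps emb_simps sg sc row col com cross out complex_cnj_zero scal_0
          mult_scaleR_right mult_1_right simp_thms)
  next
    case T1
    then show ?thesis using prod_s_nonzero[OF q, of n] T
      by (simp add: emb_simps emb_GL_star_qdet[OF q] emb_GL_star_T scal_1)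
  next
    case T2
    then show ?thesis using prod_s_nonzero[OF q, of n] T
      by (simp add: emb_simps emb_GL_star_qdet[OF q] emb_GL_star_T scal_1)
  qed
  then show ?thesis unfolding emb_GL_eq_iff .
qed

lemma pcong_star_GL:
  "q \<noteq> 0 \<Longrightarrow> pcong (relGL q n) x y \<Longrightarrow> pcong (relGL q n) (star_GL q n x) (star_GL q n y)"
  using pcong_astar star_GL_rel by blast

lemma star_GL_involutive:
  assumes "q \<noteq> 0"
  shows "pcong (relGL q n) (star_GL q n (star_GL q n x)) x"
proof (induction x)
  case (EGen g)
  show ?case
  proof (cases g)
    case (ZBg a al)
    then show ?thesis using star_GL_wexpr[OF assms] by (simp add: star_gen_ZBg)
  next
    case Tg
    have sc: "scal (cnj (of_real x)) = x *\<^sub>R 1" for x by (simp add: scal_of_real)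
    have "emb_GL q n (star_GL q n (star_gen q n Tg)) = emb_GL q n (EGen Tg)"
      unfolding star_gen_Tg astar.simps emb_simps sc emb_GL_star_qdet[OF assms]
      using prod_s_nonzero[OF assms, of n] by simp
    then show ?thesis unfolding Tg by (simp add: emb_GL_eq_iff)
  qed
qed (auto intro: prefl padd_cong pmul_cong)

text \<open>On a generator \<open>Zsg\<close> this is \<open>z** = z\<close>. It is proved before
  \<open>psi\<close> is known to respect the relations, because the starred relations of the source
  are derived from it.\<close>

lemma psi_estar:
  assumes "q \<noteq> 0"
  shows "pcong (relGL q n) (psi q n (estar e)) (star_GL q n (psi q n e))"
proof (induction e)
  case (EGen g)
  then show ?case using psym[OF star_GL_wexpr[OF assms]]
    by (cases g) (auto simp: psi_gen_def star_gen_ZBg intro: prefl)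
qed (auto intro: prefl padd_cong pmul_cong)

lemma psi_relCross:
  assumes q: "q \<noteq> 0" and "(l, r) \<in> relCross q n"
  shows "pcong (relGL q n) (psi q n l) (psi q n r)"
proof -
  have ev: "emb_GL q n (psi q n e) = ev scal (\<lambda>g. emb_GL q n (psi_gen q n g)) e" for e
    by (induction e) (simp_all add: emb_simps)
  have g: "emb_GL q n (psi_gen q n (Zg a al)) = zGL q n a al"
    "emb_GL q n (psi_gen q n (Zsg a al)) = wGL q n a al" for a al
    by (simp_all add: psi_gen_def emb_GL_wexpr[OF q])
  have idx: "(\<Sum>x\<leftarrow>idx n. f x) = (\<Sum>x\<in>{1..n}. f x)" for f :: "nat \<Rightarrow> genB palg"
    by (simp add: idx_eq sum.distinct_set_conv_list[symmetric])
  obtain a b al be where ab: "a \<in> {1..n}" "b \<in> {1..n}" "al \<in> {1..n}" "be \<in> {1..n}"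
    and l: "l = EMul (EGen (Zsg b be)) (EGen (Zg a al))"
    and r: "r = EAdd (EMul (EScal (of_real (q ^ 2)))
              (esum (concat (concat (concat
                 (map (\<lambda>a'. map (\<lambda>b'. map (\<lambda>al'. map (\<lambda>be'.
                    EMul (EScal (of_real (Rc q b a b' a' * Rc q be al be' al')))
                         (EMul (EGen (Zg a' al')) (EGen (Zsg b' be'))))
                   (idx n)) (idx n)) (idx n)) (idx n)))))))
           (EScal (of_real ((1 - q ^ 2) * (if a = b \<and> al = be then 1 else 0))))"
    using assms(2) unfolding relCross_def by blast
  have "ev scal (\<lambda>g. emb_GL q n (psi_gen q n g)) r = q\<^sup>2 *\<^sub>R (\<Sum>a'\<in>{1..n}. \<Sum>b'\<in>{1..n}. \<Sum>\<alpha>'\<in>{1..n}. \<Sum>\<beta>'\<in>{1..n}.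
      (Rc q b a b' a' * Rc q be al \<beta>' \<alpha>') *\<^sub>R (zGL q n a' \<alpha>' * wGL q n b' \<beta>'))
    + ((1 - q\<^sup>2) * (if a = b \<and> al = be then 1 else 0)) *\<^sub>R 1"
    unfolding r ev.simps ev_esum[of scal, OF scal_0]
    by (simp only: map_concat map_map comp_def sum_list_concat ev.simps g idx scal_of_real
        mult_scaleR_left mult_1_left)
  also have "\<dots> = ev scal (\<lambda>g. emb_GL q n (psi_gen q n g)) l"
    unfolding l ev.simps g
    by (rule qgl.cross_relation[OF qgl_GL[OF q] ab(1,2,3,4), symmetric])
  finally show ?thesis unfolding emb_GL_eq_iff[symmetric] ev ..
qed

text \<open>A starred relation is carried to the star of the image of the original one, and the star
  on the target respects congruence.\<close>

lemma psi_rel: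
  assumes q: "q \<noteq> 0" and "(l, r) \<in> relMat q n"
  shows "pcong (relGL q n) (psi q n l) (psi q n r)"
proof -
  have S: "pcong (relGL q n) (psi q n l) (psi q n r)" if "(l, r) \<in> relR Zg q n \<union> relCross q n" for l r
  proof (cases "(l, r) \<in> relCross q n")
    case False
    then have "(l, r) \<in> relR Zg q n" using that by blast
    then have "(psi q n l, psi q n r) \<in> relR ZBg q n"
      unfolding relR_def
      by (elim UnE CollectE exE conjE disjE Pair_inject; clarsimp simp: psi_gen_def; blast?)
    then show ?thesis by (auto simp: relGL_def intro: prel)
  qed (use psi_relCross[OF q] in blast)
  consider "(l, r) \<in> relR Zg q n \<union> relCross q n"
    | l' r' where "l = estar l'" "r = estar r'" "(l', r') \<in> relR Zg q n \<union> relCross q n"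
    using assms(2) unfolding relMat_def Let_def by auto
  then show ?thesis
  proof cases
    case 2
    then show ?thesis
      using psi_estar[OF q] pcong_star_GL[OF q S] by (meson psym ptrans)
  qed (rule S)
qed

lemma pcong_psi: "q \<noteq> 0 \<Longrightarrow> pcong (relMat q n) x y \<Longrightarrow> pcong (relGL q n) (psi q n x) (psi q n y)"
  using pcong_esubst psi_rel by blast

section \<open>Passage to congruence classes\<close>

lemma pclass_eq_iff: "pclass R x = pclass R y \<longleftrightarrow> pcong R x y"
proof
  assume "pclass R x = pclass R y"
  then show "pcong R x y" unfolding pclass_def using prefl by blast
next
  assume "pcong R x y"
  then show "pclass R x = pclass R y" unfolding pclass_def by (auto intro: psym ptrans)
qed

text \<open>The operations on classes are unions over representatives; once a map respects
  congruence, all members of the union coincide.\<close>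

lemma UN_pclass:
  assumes "\<And>x'. pcong R x x' \<Longrightarrow> pcong R' (f x) (f x')"
  shows "(\<Union>x'\<in>pclass R x. pclass R' (f x')) = pclass R' (f x)"
proof -
  have "pclass R' (f x') = pclass R' (f x)" if "x' \<in> pclass R x" for x'
    using assms that by (auto simp: pclass_def[of R] pclass_eq_iff intro: psym)
  moreover have "x \<in> pclass R x" by (simp add: pclass_def prefl)
  ultimately show ?thesis by blast
qed

lemma pres_mult: "pclass R x \<otimes>\<^bsub>pres_alg R\<^esub> pclass R y = pclass R (EMul x y)"
proof -
  have "(\<Union>y'\<in>pclass R y. pclass R (EMul x' y')) = pclass R (EMul x' y)" for x'
    by (rule UN_pclass) (auto intro: prefl pmul_cong)
  then show ?thesis by (simp add: pres_alg_def) (rule UN_pclass, auto intro: prefl pmul_cong)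
qed

lemma pres_add: "pclass R x \<oplus>\<^bsub>pres_alg R\<^esub> pclass R y = pclass R (EAdd x y)"
proof -
  have "(\<Union>y'\<in>pclass R y. pclass R (EAdd x' y')) = pclass R (EAdd x' y)" for x'
    by (rule UN_pclass) (auto intro: prefl padd_cong)
  then show ?thesis by (simp add: pres_alg_def) (rule UN_pclass, auto intro: prefl padd_cong)
qed

lemma pres_one: "\<one>\<^bsub>pres_alg R\<^esub> = pclass R (EScal 1)"
  by (simp add: pres_alg_def)

lemma pres_carrier: "carrier (pres_alg R) = range (pclass R)"
  by (simp add: pres_alg_def)

lemma pres_smul_pclass: "pres_smul R c (pclass R x) = pclass R (EMul (EScal c) x)"
  unfolding pres_smul_def by (rule UN_pclass) (auto intro: prefl pmul_cong)

lemma estar_estar: "estar (estar x) = x"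
proof (induction x)
  case (EGen g)
  then show ?case by (cases g) auto
qed auto

lemma estar_eq_astar: "estar = astar (\<lambda>g. EGen (gstar g))"
proof
  show "estar x = astar (\<lambda>g. EGen (gstar g)) x" for x by (induction x) auto
qed

lemma pcong_estar:
  assumes "pcong (relMat q n) x y"
  shows "pcong (relMat q n) (estar x) (estar y)"
  unfolding estar_eq_astar
proof (rule pcong_astar[OF assms], unfold estar_eq_astar[symmetric])
  fix l r assume "(l, r) \<in> relMat q n"
  then have "(estar l, estar r) \<in> relMat q n"
    unfolding relMat_def Let_def using estar_estar by (force simp: image_iff)
  then show "pcong (relMat q n) (estar l) (estar r)" by (rule prel)
qed

lemma starMat_pclass: "starMat q n (pclass (relMat q n) x) = pclass (relMat q n) (estar x)"
  unfolding starMat_def by (rule UN_pclass) (rule pcong_estar)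

text \<open>The choice operator yields these properties as soon as some map has them; the witness is
  the map induced by \<open>star_GL\<close>.\<close>

lemma starSU_spec:
  assumes q: "q \<noteq> 0"
  shows "starSU q n \<in> carrier (GLq q n) \<rightarrow>\<^sub>E carrier (GLq q n) \<and>
      is_involution (GLq q n) (pres_smul (relGL q n)) (starSU q n) \<and>
      (\<forall>a\<in>{1..n}. \<forall>al\<in>{1..n}.
         starSU q n (pclass (relGL q n) (EGen (ZBg a al))) =
         pclass (relGL q n)
           (EMul (EScal (complex_of_real (- q) powi (int a + int al - 2 * int n)))
                 (EMul (EGen Tg) (qdet_compl ZBg q n a al))))"
proof -
  let ?R = "relGL q n"
  define f where "f = (\<lambda>X\<in>carrier (GLq q n). \<Union>x\<in>X. pclass ?R (star_GL q n x))"
  have f: "f (pclass ?R x) = pclass ?R (star_GL q n x)" for x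
    unfolding f_def GLq_def pres_carrier by (simp add: UN_pclass pcong_star_GL[OF q])
  have "is_involution (GLq q n) (pres_smul ?R) f"
    unfolding is_involution_def GLq_def pres_carrier
    by (auto simp: f pres_add pres_mult pres_smul_pclass pclass_eq_iff star_GL_involutive[OF q]
      intro: psym pscal_central)
  moreover have "f \<in> carrier (GLq q n) \<rightarrow>\<^sub>E carrier (GLq q n)"
    unfolding PiE_def
  proof
    show "f \<in> carrier (GLq q n) \<rightarrow> carrier (GLq q n)" by (auto simp: f GLq_def pres_carrier)
  qed (simp add: f_def)
  moreover have "\<forall>a\<in>{1..n}. \<forall>al\<in>{1..n}. f (pclass ?R (EGen (ZBg a al))) = pclass ?R
           (EMul (EScal (complex_of_real (- q) powi (int a + int al - 2 * int n)))
                 (EMul (EGen Tg) (qdet_compl ZBg q n a al)))"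
    by (auto simp: f star_gen_ZBg wexpr_def)
  ultimately show ?thesis unfolding starSU_def by (rule_tac someI[of _ f]) blast
qed

lemma starSU_properties:
  assumes q: "q \<noteq> 0"
  shows starSU_mult: "starSU q n (pclass (relGL q n) (EMul x y)) = starSU q n (pclass (relGL q n) y) \<otimes>\<^bsub>GLq q n\<^esub> starSU q n (pclass (relGL q n) x)"
    and starSU_add: "starSU q n (pclass (relGL q n) (EAdd x y)) = starSU q n (pclass (relGL q n) x) \<oplus>\<^bsub>GLq q n\<^esub> starSU q n (pclass (relGL q n) y)"
    and starSU_smul: "starSU q n (pclass (relGL q n) (EMul (EScal c) x)) = pres_smul (relGL q n) (cnj c) (starSU q n (pclass (relGL q n) x))"
    and starSU_starSU: "starSU q n (starSU q n (pclass (relGL q n) x)) = pclass (relGL q n) x"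
    and starSU_gen: "a \<in> {1..n} \<Longrightarrow> al \<in> {1..n} \<Longrightarrow> starSU q n (pclass (relGL q n) (EGen (ZBg a al))) = pclass (relGL q n) (wexpr q n a al)"
    and starSU_range: "\<exists>y. starSU q n (pclass (relGL q n) x) = pclass (relGL q n) y"
proof -
  let ?C = "pclass (relGL q n)"
  have inv: "is_involution (GLq q n) (pres_smul (relGL q n)) (starSU q n)"
    using starSU_spec[OF q] by blast
  have c: "?C x \<in> carrier (GLq q n)" for x by (simp add: GLq_def pres_carrier)
  have m: "?C (EMul x y) = ?C x \<otimes>\<^bsub>GLq q n\<^esub> ?C y" "?C (EAdd x y) = ?C x \<oplus>\<^bsub>GLq q n\<^esub> ?C y"
    "?C (EMul (EScal d) x) = pres_smul (relGL q n) d (?C x)" for x y d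
    by (simp_all add: GLq_def pres_mult pres_add pres_smul_pclass)
  show "starSU q n (?C (EMul x y)) = starSU q n (?C y) \<otimes>\<^bsub>GLq q n\<^esub> starSU q n (?C x)"
    unfolding m(1) using inv c by (simp add: is_involution_def)
  show "starSU q n (?C (EAdd x y)) = starSU q n (?C x) \<oplus>\<^bsub>GLq q n\<^esub> starSU q n (?C y)"
    unfolding m(2) using inv c by (simp add: is_involution_def)
  show "starSU q n (?C (EMul (EScal c) x)) = pres_smul (relGL q n) (cnj c) (starSU q n (?C x))"
    unfolding m(3) using inv c by (simp add: is_involution_def)
  show "starSU q n (starSU q n (?C x)) = ?C x" using inv c by (simp add: is_involution_def)
  show "\<exists>y. starSU q n (?C x) = ?C y"
  proof -
    have "starSU q n (?C x) \<in> carrier (GLq q n)" using inv c by (auto simp: is_involution_def)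
    then show ?thesis by (auto simp: GLq_def pres_carrier)
  qed
  show "starSU q n (?C (EGen (ZBg a al))) = ?C (wexpr q n a al)" if "a \<in> {1..n}" "al \<in> {1..n}"
    using starSU_spec[OF q, of n] that unfolding wexpr_def by simp
qed

lemma starSU_scal:
  assumes q: "q \<noteq> 0"
  shows "starSU q n (pclass (relGL q n) (EScal c)) = pclass (relGL q n) (EScal (cnj c))"
proof -
  let ?C = "pclass (relGL q n)"
  obtain e where e: "starSU q n (?C (EScal 1)) = ?C e" using starSU_range[OF q] by blast
  \<comment> \<open>The axioms of an involution do not list preservation of the unit. Applying the
    involution to \<open>1 * e\<close>, where \<open>e\<close> is the image of 1, gives
    \<open>e = 1\<close> because \<open>e\<close> is mapped back to 1.\<close>
  have one: "?C e = ?C (EScal 1)"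
  proof -
    have "starSU q n (?C e) = ?C (EScal 1)" unfolding e[symmetric] by (rule starSU_starSU[OF q])
    moreover have "starSU q n (?C (EMul (EScal 1) e)) = starSU q n (?C e) \<otimes>\<^bsub>GLq q n\<^esub> ?C e"
      unfolding starSU_mult[OF q] e ..
    moreover have "?C (EMul (EScal 1) e) = ?C e" by (simp add: pclass_eq_iff pmul_one_l)
    ultimately have "?C (EScal 1) = ?C (EMul (EScal 1) e)" by (simp add: GLq_def pres_mult)
    then show ?thesis by (simp add: pclass_eq_iff) (meson pmul_one_l psym ptrans)
  qed
  have "?C (EScal c) = ?C (EMul (EScal c) (EScal 1))" by (simp add: pclass_eq_iff psym pmul_one_r)
  then have "starSU q n (?C (EScal c)) = pres_smul (relGL q n) (cnj c) (?C (EScal 1))"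
    by (simp only: starSU_smul[OF q] e one)
  then show ?thesis by (simp add: pres_smul_pclass pclass_eq_iff pmul_one_r)
qed

text \<open>Images under \<open>psi\<close> are built from scalars, \<open>z\<close> and
  \<open>w\<close>. On \<open>z\<close> the chosen involution is prescribed and on \<open>w\<close>
  it is determined by being involutive, so the identity holds whichever involution was
  chosen.\<close>

lemma starSU_psi:
  assumes q: "q \<noteq> 0"
  shows "starSU q n (pclass (relGL q n) (psi q n e)) = pclass (relGL q n) (psi q n (estar e))"
proof (induction e)
  case (EGen g)
  let ?C = "pclass (relGL q n)"
  have out: "?C (EGen (ZBg a al)) = ?C (EScal 0)" if "\<not> (a \<in> {1..n} \<and> al \<in> {1..n})" for a al
    using that unfolding pclass_eq_iff by (intro prel) (auto simp: relGL_def relR_def)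
  have gen: "starSU q n (?C (EGen (ZBg a al))) = ?C (wexpr q n a al)" for a al
  proof (cases "a \<in> {1..n} \<and> al \<in> {1..n}")
    case False
    then show ?thesis unfolding out[OF False] using starSU_scal[OF q] by (auto simp: wexpr_def)
  qed (use starSU_gen[OF q] in blast)
  show ?case
  proof (cases g)
    case (Zg a al)
    then show ?thesis using gen by (simp add: psi_gen_def)
  next
    case (Zsg a al)
    then show ?thesis using starSU_starSU[OF q, of n "EGen (ZBg a al)"] by (simp add: psi_gen_def gen)
  qed
next
  case (EScal c)
  then show ?case by (simp add: starSU_scal[OF q])
next
  case (EAdd x y)
  then show ?case by (simp add: starSU_add[OF q]) (simp add: GLq_def pres_add)
next
  case (EMul x y)
  then show ?case by (simp add: starSU_mult[OF q]) (simp add: GLq_def pres_mult)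
qed

section \<open>Existence and uniqueness of the homomorphism of star-algebras\<close>

theorem theorem1:
  fixes q :: real and n :: nat
  assumes "0 < q" and "q < 1" and "1 \<le> n"
  shows "\<exists>!\<psi>. \<psi> \<in> carrier (PolMat q n) \<rightarrow>\<^sub>E carrier (GLq q n) \<and>
           \<psi> \<in> ring_hom (PolMat q n) (GLq q n) \<and>
           (\<forall>c. \<forall>x\<in>carrier (PolMat q n).
              \<psi> (pres_smul (relMat q n) c x) = pres_smul (relGL q n) c (\<psi> x)) \<and>
           (\<forall>x\<in>carrier (PolMat q n). \<psi> (starMat q n x) = starSU q n (\<psi> x)) \<and>
           (\<forall>a\<in>{1..n}. \<forall>al\<in>{1..n}.
              \<psi> (pclass (relMat q n) (EGen (Zg a al))) = pclass (relGL q n) (EGen (ZBg a al)))"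
    (is "\<exists>!\<psi>. ?P \<psi>")
proof -
  have q: "q \<noteq> 0" using assms(1) by simp
  let ?M = "pclass (relMat q n)" and ?G = "pclass (relGL q n)"
  have cM: "carrier (PolMat q n) = range ?M" and cG: "carrier (GLq q n) = range ?G"
    by (simp_all add: PolMat_def GLq_def pres_carrier)
  define \<psi> where "\<psi> = (\<lambda>X\<in>carrier (PolMat q n). \<Union>x\<in>X. ?G (psi q n x))"
  have \<psi>: "\<psi> (?M x) = ?G (psi q n x)" for x
    unfolding \<psi>_def cM by (simp add: UN_pclass pcong_psi[OF q])
  have "?P \<psi>"
  proof (intro conjI)
    show "\<psi> \<in> carrier (PolMat q n) \<rightarrow>\<^sub>E carrier (GLq q n)"
      unfolding PiE_def
    proof
      show "\<psi> \<in> carrier (PolMat q n) \<rightarrow> carrier (GLq q n)" by (auto simp: \<psi> cM cG)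
    qed (simp add: \<psi>_def)
    show "\<psi> \<in> ring_hom (PolMat q n) (GLq q n)"
      by (rule ring_hom_memI) (auto simp: cM cG \<psi>, auto simp: PolMat_def GLq_def pres_mult pres_add pres_one \<psi>)
  qed (auto simp: cM \<psi> pres_smul_pclass starMat_pclass starSU_psi[OF q] psi_gen_def)
  moreover have "\<phi> = \<psi>" if \<phi>: "?P \<phi>" for \<phi>
  proof -
    have hom: "\<phi> \<in> ring_hom (PolMat q n) (GLq q n)" using \<phi> by blast
    have mM: "?M x \<in> carrier (PolMat q n)" for x by (simp add: cM)
    have sc: "\<phi> (?M (EScal c)) = ?G (EScal c)" for c
    proof -
      have "?M (EScal c) = pres_smul (relMat q n) c (?M (EScal 1))"
        by (simp add: pres_smul_pclass pclass_eq_iff pmul_one_r psym)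
      then have "\<phi> (?M (EScal c)) = pres_smul (relGL q n) c (\<phi> (?M (EScal 1)))" using \<phi> mM by simp
      also have "\<phi> (?M (EScal 1)) = ?G (EScal 1)"
        using ring_hom_one[OF hom] by (simp add: PolMat_def GLq_def pres_one)
      finally show ?thesis by (simp add: pres_smul_pclass pclass_eq_iff pmul_one_r)
    qed
    \<comment> \<open>The theorem prescribes values only for indices in range; the remaining
      generators are 0 on both sides.\<close>
    have gen: "\<phi> (?M (EGen (Zg a al))) = ?G (EGen (ZBg a al))" for a al
    proof (cases "a \<in> {1..n} \<and> al \<in> {1..n}")
      case False
      have "?M (EGen (Zg a al)) = ?M (EScal 0)"
        unfolding pclass_eq_iff by (rule prel) (use False in \<open>auto simp: relMat_def relR_def Let_def\<close>)
      moreover have "?G (EGen (ZBg a al)) = ?G (EScal 0)"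
        unfolding pclass_eq_iff by (rule prel) (use False in \<open>auto simp: relGL_def relR_def\<close>)
      ultimately show ?thesis by (simp add: sc)
    qed (use \<phi> in blast)
    have "\<phi> (?M x) = ?G (psi q n x)" for x
    proof (induction x)
      case (EGen g)
      show ?case
      proof (cases g)
        case (Zg a al)
        then show ?thesis by (simp add: gen psi_gen_def)
      next
        case (Zsg a al)
        \<comment> \<open>Compatibility with the stars determines the value on a starred generator
          from the value on the unstarred one.\<close>
        have "\<phi> (?M (EGen (Zsg a al))) = \<phi> (starMat q n (?M (EGen (Zg a al))))"
          by (simp add: starMat_pclass)
        also have "\<dots> = starSU q n (\<phi> (?M (EGen (Zg a al))))" using \<phi> mM by blast
        also have "\<dots> = starSU q n (?G (psi q n (EGen (Zg a al))))" by (simp add: gen psi_gen_def)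
        finally show ?thesis using Zsg by (simp add: starSU_psi[OF q] del: esubst.simps)
      qed
    next
      case (EMul x y)
      then show ?case using ring_hom_mult[OF hom mM mM, of x y]
        by (simp add: PolMat_def GLq_def pres_mult)
    next
      case (EAdd x y)
      then show ?case using ring_hom_add[OF hom mM mM, of x y]
        by (simp add: PolMat_def GLq_def pres_add)
    qed (simp add: sc)
    then have eq: "\<phi> X = \<psi> X" if "X \<in> carrier (PolMat q n)" for X using that by (auto simp: cM \<psi>)
    have "\<phi> \<in> carrier (PolMat q n) \<rightarrow>\<^sub>E carrier (GLq q n)" "\<psi> \<in> carrier (PolMat q n) \<rightarrow>\<^sub>E carrier (GLq q n)"
      using \<phi> \<open>?P \<psi>\<close> by blast+
    then show ?thesis by (rule PiE_ext) (rule eq)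
  qed
  ultimately show ?thesis by (rule ex1I)
qed

end
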